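(* Let $\mathcal{T}$ be a compactly generated triangulated category that admits a compact silting object $M$, and let $\mathcal{H}_M$ be the heart of the t-structure associated with $M$. The following are equivalent: (i) $\mathrm{gl.dim}_{\mathcal{H}_M}\mathcal{T}<\infty$; (ii) $\mathcal{T}^{\mathsf{b}}\subseteq \mathcal{T}^{\mathsf{b}}_p$; (iii) $\mathcal{T}^{\mathsf{b}}\subseteq \mathcal{T}^{\mathsf{b}}_i$. In particular, if $\mathrm{Hom}_{\mathcal{T}}(M,M[n])=0$ for $|n|\gg 0$, then $\mathrm{gl.dim}_{\mathcal{H}_M}\mathcal{T}$ is finite if and only if $\mathcal{T}$ has finite global dimension, i.e. $\mathcal{T}^{\mathsf{b}}=\mathcal{T}^{\mathsf{b}}_p$.
   Context: $\mathcal{T}^{\mathsf{c}}$ denotes the subcategory of compact objects of $\mathcal{T}$. An object $M$ of a compactly generated triangulated category $\mathcal{T}$ is a compact silting object if $M\in\mathcal{T}^{\mathsf{c}}$, $\mathrm{Hom}_{\mathcal{T}}(M,M[i])=0$ for all $i>0$, and the thick closure of $M$ is $\mathcal{T}^{\mathsf{c}}$. For a set $I$ of integers, $M^{\perp_I}=\{y\in\mathcal{T}:\mathrm{Hom}_{\mathcal{T}}(M,y[i])=0\ \forall i\in I\}$. It is known that $(M^{\perp_{>0}},M^{\perp_{\leq 0}})$ is then a t-structure in $\mathcal{T}$ (a t-structure is a pair $(\mathcal{U},\mathcal{V})$ with $\mathcal{U}={}^{\perp}\mathcal{V}$, $\mathcal{U}^\perp=\mathcal{V}$, $\mathcal{T}=\mathcal{U}*\mathcal{V}$,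 $\mathcal{U}[1]\subseteq\mathcal{U}$; its heart is $\mathcal{U}\cap\mathcal{V}[1]$), with heart $\mathcal{H}_M=M^{\perp_{\neq 0}}$. For a t-structure with heart $\mathcal{H}$ and $x\in\mathcal{T}$, $\mathrm{pdim}_{\mathcal{H}}x$ is the infimum of those $n\in\mathbb{Z}\cup\{-\infty,+\infty\}$ such that $\mathrm{Hom}_{\mathcal{T}}(x,y[i])=0$ for all $i>n$ and all $y\in\mathcal{H}$. The global dimension of $\mathcal{T}$ relative to $\mathcal{H}$, $\mathrm{gl.dim}_{\mathcal{H}}\mathcal{T}$, is $\sup\{\mathrm{pdim}_{\mathcal{H}}x : x\in\mathcal{H}\}$. Define the subcategories: $\mathcal{T}^{\mathsf{b}}=\{t\in\mathcal{T}:\forall x\in\mathcal{T}^{\mathsf{c}},\ \mathrm{Hom}_{\mathcal{T}}(x,t[n])=0\text{ for }|n|\gg0\}$ (bounded objects); $\mathcal{T}^{\mathsf{b}}_p=\{t\in\mathcal{T}:\forall x\in\mathcal{T}^{\mathsf{b}},\ \mathrm{Hom}_{\mathcal{T}}(t,x[n])=0\text{ for }|n|\gg0\}$ (bounded projective objects); $\mathcal{T}^{\mathsf{b}}_i=\{t\in\mathcal{T}:\forall x\in\mathcal{T}^{\mathsf{b}},\ \mathrm{Hom}_{\mathcal{T}}(x,t[n])=0\text{ for }|n|\gg0\}$ (bounded injective objects). Here the bounds on $n$ may depend on both $t$ and $x$. The category $\mathcal{T}$ is said to have finite global dimension if $\mathcal{T}^{\mathsf{b}}=\mathcal{T}^{\mathsf{b}}_p$.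 *)

theory Defs
  imports
    "HOL-Library.Extended_Real"
    "HOL-Library.Countable_Set"
    "HOL-Library.Equipollence"
    "HOL-Algebra.Free_Abelian_Groups"
begin

section \<open>Triangulated categories\<close>

text \<open>
  A category is given by a set of objects and pairwise disjoint sets of morphisms, so that
  composition, addition and the action of the shift on morphisms need no object arguments;
  they are only meaningful on composable (parallel) morphisms.  In \<open>g \<cdot> f\<close> the morphism \<open>f\<close>
  is applied first.  A triangle \<open>x \<rightarrow> y \<rightarrow> z \<rightarrow> x[1]\<close> is recorded as its triple of morphisms.
\<close>

record ('o, 'm) tricat =
  Obj :: "'o set"
  Hom :: "'o \<Rightarrow> 'o \<Rightarrow> 'm set"
  Ident :: "'o \<Rightarrow> 'm"
  Comp :: "'m \<Rightarrow> 'm \<Rightarrow> 'm"  (infixr \<open>\<cdot>\<index>\<close> 70)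
  Plus :: "'m \<Rightarrow> 'm \<Rightarrow> 'm"
  Zero :: "'o \<Rightarrow> 'o \<Rightarrow> 'm"
  ShiftO :: "'o \<Rightarrow> 'o"
  ShiftM :: "'m \<Rightarrow> 'm"
  Dist :: "('m \<times> 'm \<times> 'm) set"

locale category =
  fixes C :: "('o, 'm) tricat" (structure)
  assumes Hom_Obj: "f \<in> Hom C x y \<Longrightarrow> x \<in> Obj C \<and> y \<in> Obj C"
    and Hom_disjoint: "\<lbrakk>f \<in> Hom C x y; f \<in> Hom C x' y'\<rbrakk> \<Longrightarrow> x = x' \<and> y = y'"
    and Ident_Hom: "x \<in> Obj C \<Longrightarrow> Ident C x \<in> Hom C x x"
    and Comp_Hom: "\<lbrakk>f \<in> Hom C x y; g \<in> Hom C y z\<rbrakk> \<Longrightarrow> g \<cdot> f \<in> Hom C x z"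
    and Comp_Ident_right: "f \<in> Hom C x y \<Longrightarrow> f \<cdot> Ident C x = f"
    and Comp_Ident_left: "f \<in> Hom C x y \<Longrightarrow> Ident C y \<cdot> f = f"
    and Comp_assoc:
      "\<lbrakk>f \<in> Hom C w x; g \<in> Hom C x y; h \<in> Hom C y z\<rbrakk> \<Longrightarrow> (h \<cdot> g) \<cdot> f = h \<cdot> (g \<cdot> f)"

definition is_iso :: "('o, 'm) tricat \<Rightarrow> 'o \<Rightarrow> 'o \<Rightarrow> 'm \<Rightarrow> bool" where
  "is_iso C x y f \<longleftrightarrow> f \<in> Hom C x y \<and>
     (\<exists>g \<in> Hom C y x. g \<cdot>\<^bsub>C\<^esub> f = Ident C x \<and> f \<cdot>\<^bsub>C\<^esub> g = Ident C y)"

text \<open>The abelian group of morphisms, in the multiplicative vocabulary of HOL-Algebra.\<close>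

definition hom_group :: "('o, 'm) tricat \<Rightarrow> 'o \<Rightarrow> 'o \<Rightarrow> 'm monoid" where
  "hom_group C x y = \<lparr>carrier = Hom C x y, monoid.mult = Plus C, one = Zero C x y\<rparr>"

definition hom_vanishes :: "('o, 'm) tricat \<Rightarrow> 'o \<Rightarrow> 'o \<Rightarrow> bool" where
  "hom_vanishes C x y \<longleftrightarrow> Hom C x y = {Zero C x y}"

definition zero_object :: "('o, 'm) tricat \<Rightarrow> 'o \<Rightarrow> bool" where
  "zero_object C z \<longleftrightarrow> z \<in> Obj C \<and> Ident C z = Zero C z z"

definition is_biproduct ::
  "('o, 'm) tricat \<Rightarrow> 'o \<Rightarrow> 'o \<Rightarrow> 'o \<Rightarrow> 'm \<Rightarrow> 'm \<Rightarrow> 'm \<Rightarrow> 'm \<Rightarrow> bool" where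
  "is_biproduct C x y s i j p q \<longleftrightarrow>
     i \<in> Hom C x s \<and> j \<in> Hom C y s \<and> p \<in> Hom C s x \<and> q \<in> Hom C s y \<and>
     p \<cdot>\<^bsub>C\<^esub> i = Ident C x \<and> q \<cdot>\<^bsub>C\<^esub> j = Ident C y \<and>
     q \<cdot>\<^bsub>C\<^esub> i = Zero C x y \<and> p \<cdot>\<^bsub>C\<^esub> j = Zero C y x \<and>
     Plus C (i \<cdot>\<^bsub>C\<^esub> p) (j \<cdot>\<^bsub>C\<^esub> q) = Ident C s"

locale additive_category = category +
  assumes hom_group: "\<lbrakk>x \<in> Obj C; y \<in> Obj C\<rbrakk> \<Longrightarrow> comm_group (hom_group C x y)"
    and Comp_Plus_right: "\<lbrakk>f \<in> Hom C x y; f' \<in> Hom C x y; g \<in> Hom C y z\<rbrakk>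
           \<Longrightarrow> g \<cdot> Plus C f f' = Plus C (g \<cdot> f) (g \<cdot> f')"
    and Comp_Plus_left: "\<lbrakk>f \<in> Hom C x y; g \<in> Hom C y z; g' \<in> Hom C y z\<rbrakk>
           \<Longrightarrow> Plus C g g' \<cdot> f = Plus C (g \<cdot> f) (g' \<cdot> f)"
    and ex_zero_object: "\<exists>z. zero_object C z"
    and ex_biproduct: "\<lbrakk>x \<in> Obj C; y \<in> Obj C\<rbrakk> \<Longrightarrow> \<exists>s i j p q. is_biproduct C x y s i j p q"

definition is_triangle ::
  "('o, 'm) tricat \<Rightarrow> 'o \<Rightarrow> 'o \<Rightarrow> 'o \<Rightarrow> 'm \<Rightarrow> 'm \<Rightarrow> 'm \<Rightarrow> bool" where
  "is_triangle C x y z f g h \<longleftrightarrow>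
     f \<in> Hom C x y \<and> g \<in> Hom C y z \<and> h \<in> Hom C z (ShiftO C x)"

definition dist_triangle ::
  "('o, 'm) tricat \<Rightarrow> 'o \<Rightarrow> 'o \<Rightarrow> 'o \<Rightarrow> 'm \<Rightarrow> 'm \<Rightarrow> 'm \<Rightarrow> bool" where
  "dist_triangle C x y z f g h \<longleftrightarrow> is_triangle C x y z f g h \<and> (f, g, h) \<in> Dist C"

text \<open>
  The shift is an additive automorphism of the category.  In \<open>TR2\<close>, the third morphism of
  the rotated triangle is the group-theoretic inverse of \<open>f[1]\<close>, that is, \<open>-f[1]\<close>.
\<close>

locale triangulated_category = additive_category +
  assumes ShiftO_bij: "bij_betw (ShiftO C) (Obj C) (Obj C)"
    and ShiftM_bij: "\<lbrakk>x \<in> Obj C; y \<in> Obj C\<rbrakk>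
           \<Longrightarrow> bij_betw (ShiftM C) (Hom C x y) (Hom C (ShiftO C x) (ShiftO C y))"
    and ShiftM_Ident: "x \<in> Obj C \<Longrightarrow> ShiftM C (Ident C x) = Ident C (ShiftO C x)"
    and ShiftM_Comp: "\<lbrakk>f \<in> Hom C x y; g \<in> Hom C y z\<rbrakk>
           \<Longrightarrow> ShiftM C (g \<cdot> f) = ShiftM C g \<cdot> ShiftM C f"
    and ShiftM_Plus: "\<lbrakk>f \<in> Hom C x y; g \<in> Hom C x y\<rbrakk>
           \<Longrightarrow> ShiftM C (Plus C f g) = Plus C (ShiftM C f) (ShiftM C g)"
    and Dist_triangle: "(f, g, h) \<in> Dist C \<Longrightarrow> \<exists>x y z. is_triangle C x y z f g h"
    and Dist_iso: "\<lbrakk>dist_triangle C x y z f g h; is_triangle C x' y' z' f' g' h';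
            is_iso C x x' a; is_iso C y y' b; is_iso C z z' c;
            b \<cdot> f = f' \<cdot> a; c \<cdot> g = g' \<cdot> b; ShiftM C a \<cdot> h = h' \<cdot> c\<rbrakk>
           \<Longrightarrow> dist_triangle C x' y' z' f' g' h'"
    and TR1_Ident: "\<lbrakk>x \<in> Obj C; zero_object C z\<rbrakk>
           \<Longrightarrow> dist_triangle C x x z (Ident C x) (Zero C x z) (Zero C z (ShiftO C x))"
    and TR1_cone: "f \<in> Hom C x y \<Longrightarrow> \<exists>z g h. dist_triangle C x y z f g h"
    and TR2: "is_triangle C x y z f g h \<Longrightarrow> dist_triangle C x y z f g h \<longleftrightarrow>
            dist_triangle C y z (ShiftO C x) g h
              (inv\<^bsub>hom_group C (ShiftO C x) (ShiftO C y)\<^esub> (ShiftM C f))"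
    and TR3: "\<lbrakk>dist_triangle C x y z f g h; dist_triangle C x' y' z' f' g' h';
            a \<in> Hom C x x'; b \<in> Hom C y y'; b \<cdot> f = f' \<cdot> a\<rbrakk>
           \<Longrightarrow> \<exists>c \<in> Hom C z z'. c \<cdot> g = g' \<cdot> b \<and> ShiftM C a \<cdot> h = h' \<cdot> c"
    and TR4: "\<lbrakk>dist_triangle C x y z' f f' f''; dist_triangle C y z x' g g' g'';
            dist_triangle C x z y' (g \<cdot> f) h' h''\<rbrakk>
           \<Longrightarrow> \<exists>u v. dist_triangle C z' y' x' u v (ShiftM C f' \<cdot> g'') \<and>
                 u \<cdot> f' = h' \<cdot> g \<and> h'' \<cdot> u = f'' \<and> v \<cdot> h' = g' \<and> g'' \<cdot> v = ShiftM C f \<cdot> h''"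

text \<open>The object \<open>x[i]\<close> for an integer \<open>i\<close>.\<close>

definition shift :: "('o, 'm) tricat \<Rightarrow> int \<Rightarrow> 'o \<Rightarrow> 'o" where
  "shift C i x = (if 0 \<le> i then (ShiftO C ^^ nat i) x
                  else (inv_into (Obj C) (ShiftO C) ^^ nat (- i)) x)"

definition direct_summand :: "('o, 'm) tricat \<Rightarrow> 'o \<Rightarrow> 'o \<Rightarrow> bool" where
  "direct_summand C x s \<longleftrightarrow> (\<exists>y i j p q. is_biproduct C x y s i j p q)"

text \<open>
  Thick subcategories are full, hence given by their objects.  Closure under direct summands
  includes closure under isomorphism, because a zero object may be taken as complement.
\<close>

definition thick :: "('o, 'm) tricat \<Rightarrow> 'o set \<Rightarrow> bool" where
  "thick C S \<longleftrightarrow> S \<subseteq> Obj C \<and> (\<forall>z. zero_object C z \<longrightarrow> z \<in> S) \<and>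
     (\<forall>x\<in>S. shift C 1 x \<in> S \<and> shift C (- 1) x \<in> S) \<and>
     (\<forall>x y z f g h. dist_triangle C x y z f g h \<longrightarrow> x \<in> S \<longrightarrow> y \<in> S \<longrightarrow> z \<in> S) \<and>
     (\<forall>x. \<forall>s\<in>S. direct_summand C x s \<longrightarrow> x \<in> S)"

abbreviation thick_closure :: "('o, 'm) tricat \<Rightarrow> 'o set \<Rightarrow> 'o set" where
  "thick_closure C A \<equiv> thick C hull A"


section \<open>Compactly generated triangulated categories\<close>

text \<open>
  Smallness is relative to an uncountable set \<open>U\<close>: a set is small if its cardinality is strictly
  below that of \<open>U\<close>.  If \<open>U\<close> is a Grothendieck universe, these are the sets in bijection with an
  element of \<open>U\<close>; no closure property of \<open>U\<close> beyond uncountability (all countable sets are small)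
  is imposed.  Index sets live in the type of \<open>U\<close>, in which every small set has a copy.
\<close>

definition is_coproduct ::
  "('o, 'm) tricat \<Rightarrow> 'i set \<Rightarrow> ('i \<Rightarrow> 'o) \<Rightarrow> 'o \<Rightarrow> ('i \<Rightarrow> 'm) \<Rightarrow> bool" where
  "is_coproduct C I X c \<iota> \<longleftrightarrow> c \<in> Obj C \<and> (\<forall>i\<in>I. X i \<in> Obj C \<and> \<iota> i \<in> Hom C (X i) c) \<and>
     (\<forall>y \<in> Obj C. \<forall>f. (\<forall>i\<in>I. f i \<in> Hom C (X i) y) \<longrightarrow>
        (\<exists>!h. h \<in> Hom C c y \<and> (\<forall>i\<in>I. h \<cdot>\<^bsub>C\<^esub> \<iota> i = f i)))"

text \<open>
  \<open>x\<close> is compact if the canonical map from the direct sum of the groups \<open>Hom(x, X i)\<close> to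
  \<open>Hom(x, c)\<close>, which sends \<open>f\<close> to the (finite) sum of the \<open>\<iota> i \<cdot> f i\<close>, is an isomorphism for
  every small coproduct \<open>c\<close> of objects \<open>X i\<close>.
\<close>

definition compact_objects :: "('o, 'm) tricat \<Rightarrow> 'u set \<Rightarrow> 'o set" where
  "compact_objects C U = {x \<in> Obj C. \<forall>(I :: 'u set) X c \<iota>. I \<prec> U \<longrightarrow> is_coproduct C I X c \<iota> \<longrightarrow>
     (\<lambda>f. gfinprod (hom_group C x c) (\<lambda>i. \<iota> i \<cdot>\<^bsub>C\<^esub> f i) I)
       \<in> Group.iso (sum_group I (\<lambda>i. hom_group C x (X i))) (hom_group C x c)}"

locale compactly_generated_category = triangulated_category C
  for C :: "('o, 'm) tricat" (structure) +
  fixes U :: "'u set"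
  assumes uncountable_U: "uncountable U"
    and locally_small: "\<lbrakk>x \<in> Obj C; y \<in> Obj C\<rbrakk> \<Longrightarrow> Hom C x y \<prec> U"
    and small_coproducts: "\<And>(I :: 'u set) X. \<lbrakk>I \<prec> U; \<forall>i\<in>I. X i \<in> Obj C\<rbrakk>
           \<Longrightarrow> \<exists>c \<iota>. is_coproduct C I X c \<iota>"
    and compact_generators: "\<exists>G. G \<subseteq> compact_objects C U \<and> G \<prec> U \<and>
           (\<forall>x \<in> Obj C. (\<forall>g\<in>G. \<forall>n. hom_vanishes C g (shift C n x)) \<longrightarrow> zero_object C x)"


section \<open>Silting objects, relative global dimension and bounded objects\<close>

definition compact_silting :: "('o, 'm) tricat \<Rightarrow> 'u set \<Rightarrow> 'o \<Rightarrow> bool" where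
  "compact_silting C U M \<longleftrightarrow> M \<in> compact_objects C U \<and>
     (\<forall>i>0. hom_vanishes C M (shift C i M)) \<and> thick_closure C {M} = compact_objects C U"

definition perp :: "('o, 'm) tricat \<Rightarrow> 'o \<Rightarrow> int set \<Rightarrow> 'o set" where
  "perp C M I = {y \<in> Obj C. \<forall>i\<in>I. hom_vanishes C M (shift C i y)}"

definition heart :: "('o, 'm) tricat \<Rightarrow> 'o set \<times> 'o set \<Rightarrow> 'o set" where
  "heart C = (\<lambda>(\<U>, \<V>). \<U> \<inter> shift C 1 ` \<V>)"

definition silting_t_structure :: "('o, 'm) tricat \<Rightarrow> 'o \<Rightarrow> 'o set \<times> 'o set" where
  "silting_t_structure C M = (perp C M {0<..}, perp C M {..0})"

definition pdim :: "('o, 'm) tricat \<Rightarrow> 'o set \<Rightarrow> 'o \<Rightarrow> ereal" where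
  "pdim C H x = Inf {n \<in> range (\<lambda>k :: int. ereal (of_int k)) \<union> {-\<infinity>, \<infinity>}.
     \<forall>i :: int. n < ereal (of_int i) \<longrightarrow> (\<forall>y\<in>H. hom_vanishes C x (shift C i y))}"

definition gldim :: "('o, 'm) tricat \<Rightarrow> 'o set \<Rightarrow> ereal" where
  "gldim C H = (SUP x\<in>H. pdim C H x)"

definition hom_bounded :: "('o, 'm) tricat \<Rightarrow> 'o \<Rightarrow> 'o \<Rightarrow> bool" where
  "hom_bounded C x y \<longleftrightarrow> (\<exists>N. \<forall>n :: int. \<bar>n\<bar> > N \<longrightarrow> hom_vanishes C x (shift C n y))"

definition bounded_objects :: "('o, 'm) tricat \<Rightarrow> 'u set \<Rightarrow> 'o set" where
  "bounded_objects C U = {t \<in> Obj C. \<forall>x \<in> compact_objects C U. hom_bounded C x t}"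

definition bounded_projective_objects :: "('o, 'm) tricat \<Rightarrow> 'u set \<Rightarrow> 'o set" where
  "bounded_projective_objects C U = {t \<in> Obj C. \<forall>x \<in> bounded_objects C U. hom_bounded C t x}"

definition bounded_injective_objects :: "('o, 'm) tricat \<Rightarrow> 'u set \<Rightarrow> 'o set" where
  "bounded_injective_objects C U = {t \<in> Obj C. \<forall>x \<in> bounded_objects C U. hom_bounded C x t}"

definition finite_global_dimension :: "('o, 'm) tricat \<Rightarrow> 'u set \<Rightarrow> bool" where
  "finite_global_dimension C U \<longleftrightarrow> bounded_objects C U = bounded_projective_objects C U"

end

theory Submission
  imports Defs
begin

text \<open>
  Write \<open>N i = M[-i]\<close>, so that \<open>Hom(N i, t)\<close> plays the role of the \<open>i\<close>-th cohomology of \<open>t\<close>. Iteratively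
  killing the maps from the \<open>N i\<close> with \<open>i\<close> in a set \<open>I\<close> and passing to a homotopy colimit gives
  approximations \<open>t \<rightarrow> Q\<close> with \<open>Q\<close> right orthogonal to these \<open>N i\<close>; for \<open>I = {..n}\<close> they are the
  truncations of the silting t-structure. Hence bounded objects are finite extensions of shifts of
  objects of the heart, which gives (i) \<open>\<Longrightarrow>\<close> (ii); (ii) and (iii) both say that any two bounded objects
  have bounded morphisms between them. Conversely, if pairs \<open>(h\<^sub>k, h'\<^sub>k)\<close> in the heart had nonzero
  morphisms in unbounded degrees, the countable coproducts of the \<open>h\<^sub>k\<close> and of the \<open>h'\<^sub>k\<close> would violate (ii).
  If \<open>M\<close> is itself bounded, approximation for \<open>I = {k<..}\<close> shows that bounded projective objects are
  bounded. This replaces the Brown--Comenetz dual of \<open>M\<close>, which need not exist here because smallness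
  in the sense of \<open>U\<close> is not closed under power sets.
\<close>

section \<open>Additive categories and compactness\<close>

context additive_category
begin

section \<open>Arithmetic in the morphism groups\<close>

abbreviation neg :: "'a \<Rightarrow> 'a \<Rightarrow> 'b \<Rightarrow> 'b" where
  "neg x y f \<equiv> inv\<^bsub>Defs.hom_group C x y\<^esub> f"

lemma Hom_objD:
  assumes "f \<in> Hom C x y"
  shows "x \<in> Obj C" "y \<in> Obj C"
  using Hom_Obj[OF assms] by auto

lemma Zero_Hom: "\<lbrakk>x \<in> Obj C; y \<in> Obj C\<rbrakk> \<Longrightarrow> Zero C x y \<in> Hom C x y"
  using monoid.one_closed[OF group.is_monoid[OF comm_group.axioms(2)[OF hom_group]]]
  by (simp add: hom_group_def)

lemma group_hom: "\<lbrakk>x \<in> Obj C; y \<in> Obj C\<rbrakk> \<Longrightarrow> group (Defs.hom_group C x y)"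
  using hom_group comm_group_def by blast

lemma Plus_Hom: "\<lbrakk>f \<in> Hom C x y; g \<in> Hom C x y\<rbrakk> \<Longrightarrow> Plus C f g \<in> Hom C x y"
  using monoid.m_closed[OF group.is_monoid[OF group_hom, of x y], of f g] Hom_objD[of f x y]
  by (simp add: hom_group_def)

lemma neg_Hom: "f \<in> Hom C x y \<Longrightarrow> neg x y f \<in> Hom C x y"
  using group.inv_closed[OF group_hom, of x y f] Hom_objD[of f x y]
  by (simp add: hom_group_def)

lemma Plus_self: "\<lbrakk>f \<in> Hom C x y; Plus C f f = f\<rbrakk> \<Longrightarrow> f = Zero C x y"
  using group.r_cancel_one'[OF group_hom, of x y f f] Hom_objD[of f x y]
  by (simp add: hom_group_def)

lemma Plus_Zero_Zero: "\<lbrakk>x \<in> Obj C; y \<in> Obj C\<rbrakk> \<Longrightarrow> Plus C (Zero C x y) (Zero C x y) = Zero C x y"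
  using monoid.l_one[OF group.is_monoid[OF group_hom, of x y], of "Zero C x y"] Zero_Hom[of x y]
  by (simp add: hom_group_def)

lemma Plus_Zero_left: "f \<in> Hom C x y \<Longrightarrow> Plus C (Zero C x y) f = f"
  using monoid.l_one[OF group.is_monoid[OF group_hom, of x y], of f] Hom_objD[of f x y]
  by (simp add: hom_group_def)

lemma Plus_neg: "f \<in> Hom C x y \<Longrightarrow> Plus C f (neg x y f) = Zero C x y"
  using group.r_inv[OF group_hom, of x y f] Hom_objD[of f x y]
  by (simp add: hom_group_def)

lemma Plus_neg_eq_Zero_iff:
  assumes "f \<in> Hom C x y" "g \<in> Hom C x y"
  shows "Plus C f (neg x y g) = Zero C x y \<longleftrightarrow> f = g"
  using group.inv_solve_right[OF group_hom, of x y "Zero C x y" f g]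
    Plus_Zero_left[OF assms(2)] assms Hom_objD[OF assms(1)] Zero_Hom[of x y]
  by (auto simp: hom_group_def)

lemma neg_unique:
  assumes "f \<in> Hom C x y" "g \<in> Hom C x y" "Plus C g f = Zero C x y"
  shows "neg x y f = g"
  using group.inv_equality[OF group_hom, of x y g f] assms Hom_objD[of f x y]
  by (simp add: hom_group_def)

lemma neg_neg: "f \<in> Hom C x y \<Longrightarrow> neg x y (neg x y f) = f"
  using group.inv_inv[OF group_hom, of x y f] Hom_objD[of f x y]
  by (simp add: hom_group_def)

lemma neg_Zero: "\<lbrakk>x \<in> Obj C; y \<in> Obj C\<rbrakk> \<Longrightarrow> neg x y (Zero C x y) = Zero C x y"
  using neg_unique[OF Zero_Hom Zero_Hom] Plus_Zero_Zero by blast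

lemma Comp_Zero_right:
  assumes "g \<in> Hom C y z" "x \<in> Obj C"
  shows "g \<cdot> Zero C x y = Zero C x z"
proof (rule Plus_self)
  have 0: "Zero C x y \<in> Hom C x y"
    using assms Hom_objD Zero_Hom by blast
  then show "g \<cdot> Zero C x y \<in> Hom C x z"
    using assms Comp_Hom by blast
  show "Plus C (g \<cdot> Zero C x y) (g \<cdot> Zero C x y) = g \<cdot> Zero C x y"
    using Comp_Plus_right[OF 0 0 assms(1)] Plus_Zero_Zero assms Hom_objD by metis
qed

lemma Comp_Zero_left:
  assumes "f \<in> Hom C x y" "z \<in> Obj C"
  shows "Zero C y z \<cdot> f = Zero C x z"
proof (rule Plus_self)
  have 0: "Zero C y z \<in> Hom C y z"
    using assms Hom_objD Zero_Hom by blast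
  then show "Zero C y z \<cdot> f \<in> Hom C x z"
    using assms Comp_Hom by blast
  show "Plus C (Zero C y z \<cdot> f) (Zero C y z \<cdot> f) = Zero C y z \<cdot> f"
    using Comp_Plus_left[OF assms(1) 0 0] Plus_Zero_Zero assms Hom_objD by metis
qed

lemma Comp_neg_right:
  assumes "f \<in> Hom C x y" "g \<in> Hom C y z"
  shows "g \<cdot> neg x y f = neg x z (g \<cdot> f)"
proof (rule neg_unique[symmetric])
  have "Plus C (neg x y f) f = Zero C x y"
    using group.l_inv[OF group_hom, of x y f] Hom_objD[of f x y] assms
    by (simp add: hom_group_def)
  then show "Plus C (g \<cdot> neg x y f) (g \<cdot> f) = Zero C x z"
    using Comp_Plus_right[OF neg_Hom[OF assms(1)] assms(1,2)] Comp_Zero_right assms Hom_objD by metis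
qed (use assms neg_Hom Comp_Hom in blast)+

lemma Comp_neg_left:
  assumes "f \<in> Hom C x y" "g \<in> Hom C y z"
  shows "neg y z g \<cdot> f = neg x z (g \<cdot> f)"
proof (rule neg_unique[symmetric])
  have "Plus C (neg y z g) g = Zero C y z"
    using group.l_inv[OF group_hom, of y z g] Hom_objD[of g y z] assms
    by (simp add: hom_group_def)
  then show "Plus C (neg y z g \<cdot> f) (g \<cdot> f) = Zero C x z"
    using Comp_Plus_left[OF assms(1) neg_Hom[OF assms(2)] assms(2)] Comp_Zero_left assms Hom_objD
    by metis
qed (use assms neg_Hom Comp_Hom in blast)+

lemma diff_Comp:
  assumes "f \<in> Hom C x y" "g \<in> Hom C y z" "g' \<in> Hom C y z"
  shows "Plus C g (neg y z g') \<cdot> f = Plus C (g \<cdot> f) (neg x z (g' \<cdot> f))"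
  using Comp_Plus_left[OF assms(1,2) neg_Hom[OF assms(3)]] Comp_neg_left[OF assms(1,3)] by simp

lemma Comp_diff:
  assumes "f \<in> Hom C x y" "f' \<in> Hom C x y" "g \<in> Hom C y z"
  shows "g \<cdot> Plus C f (neg x y f') = Plus C (g \<cdot> f) (neg x z (g \<cdot> f'))"
  using Comp_Plus_right[OF assms(1) neg_Hom[OF assms(2)] assms(3)] Comp_neg_right[OF assms(2,3)] by simp

section \<open>Vanishing morphism groups, zero objects and retracts\<close>

lemma hom_vanishes_iff:
  assumes "x \<in> Obj C" "y \<in> Obj C"
  shows "hom_vanishes C x y \<longleftrightarrow> (\<forall>f \<in> Hom C x y. f = Zero C x y)"
  using Zero_Hom[OF assms] by (auto simp: hom_vanishes_def)

lemma hom_vanishesD: "\<lbrakk>hom_vanishes C x y; f \<in> Hom C x y\<rbrakk> \<Longrightarrow> f = Zero C x y"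
  by (auto simp: hom_vanishes_def)

lemma zero_object_iff:
  assumes "z \<in> Obj C"
  shows "zero_object C z \<longleftrightarrow> hom_vanishes C z z"
proof
  assume z: "zero_object C z"
  have "f = Zero C z z" if "f \<in> Hom C z z" for f
    using z Comp_Ident_right[OF that] Comp_Zero_right[OF that assms] by (simp add: zero_object_def)
  then show "hom_vanishes C z z"
    using assms hom_vanishes_iff by blast
next
  assume "hom_vanishes C z z"
  then show "zero_object C z"
    using assms hom_vanishesD[OF _ Ident_Hom] by (simp add: zero_object_def)
qed

lemma hom_vanishes_zero_object:
  assumes "zero_object C z" "x \<in> Obj C"
  shows "hom_vanishes C x z" "hom_vanishes C z x"
proof -
  have z: "z \<in> Obj C" "Ident C z = Zero C z z"
    using assms(1) by (auto simp: zero_object_def)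
  show "hom_vanishes C x z"
    using hom_vanishes_iff[OF assms(2) z(1)] Comp_Ident_left Comp_Zero_left z by metis
  show "hom_vanishes C z x"
    using hom_vanishes_iff[OF z(1) assms(2)] Comp_Ident_right Comp_Zero_right z by metis
qed

text \<open>A one-sided splitting is all that the vanishing arguments need: no complement has to be
  named, and the shift preserves it by functoriality.\<close>

definition retract :: "'a \<Rightarrow> 'a \<Rightarrow> bool" where
  "retract x y \<longleftrightarrow> (\<exists>i \<in> Hom C x y. \<exists>p \<in> Hom C y x. p \<cdot> i = Ident C x)"

text \<open>Any \<open>f\<close> equals \<open>q \<cdot> (j \<cdot> f \<cdot> p) \<cdot> i\<close>,
  and the bracket lies in the vanishing group.\<close>

lemma hom_vanishes_retract:
  assumes "retract x x'" "retract y y'" "hom_vanishes C x' y'"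
  shows "hom_vanishes C x y"
proof -
  obtain i p where ip: "i \<in> Hom C x x'" "p \<in> Hom C x' x" "p \<cdot> i = Ident C x"
    using assms(1) by (auto simp: retract_def)
  obtain j q where jq: "j \<in> Hom C y y'" "q \<in> Hom C y' y" "q \<cdot> j = Ident C y"
    using assms(2) by (auto simp: retract_def)
  have obj: "x \<in> Obj C" "y \<in> Obj C" "x' \<in> Obj C" "y' \<in> Obj C"
    using ip jq Hom_objD by blast+
  have "f = Zero C x y" if f: "f \<in> Hom C x y" for f
  proof -
    have fp: "f \<cdot> p \<in> Hom C x' y" using Comp_Hom[OF ip(2) f] .
    have "j \<cdot> (f \<cdot> p) = Zero C x' y'"
      using hom_vanishesD[OF assms(3) Comp_Hom[OF fp jq(1)]] .
    then have "f \<cdot> p = Zero C x' y"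
      using Comp_assoc[OF fp jq(1,2)] Comp_Ident_left[OF fp] jq(3) Comp_Zero_right[OF jq(2) obj(3)]
      by simp
    then show ?thesis
      using Comp_assoc[OF ip(1,2) f] Comp_Ident_right[OF f] ip(3) Comp_Zero_left[OF ip(1) obj(2)]
      by simp
  qed
  then show ?thesis
    using obj hom_vanishes_iff by blast
qed

lemma retract_refl: "x \<in> Obj C \<Longrightarrow> retract x x"
  unfolding retract_def using Ident_Hom[of x] Comp_Ident_left[OF Ident_Hom[of x]] by blast

lemma direct_summand_retract: "direct_summand C x s \<Longrightarrow> retract x s"
  by (auto simp: direct_summand_def is_biproduct_def retract_def)

section \<open>Coproducts and compact objects\<close>

lemma coproduct_Hom: "\<lbrakk>is_coproduct C I X c \<iota>; i \<in> I\<rbrakk> \<Longrightarrow> \<iota> i \<in> Hom C (X i) c"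
  by (auto simp: is_coproduct_def)

lemma coproduct_Obj: "is_coproduct C I X c \<iota> \<Longrightarrow> c \<in> Obj C"
  by (simp add: is_coproduct_def)

lemma coproduct_desc:
  assumes "is_coproduct C I X c \<iota>" "y \<in> Obj C" "\<And>i. i \<in> I \<Longrightarrow> f i \<in> Hom C (X i) y"
  obtains h where "h \<in> Hom C c y" "\<And>i. i \<in> I \<Longrightarrow> h \<cdot> \<iota> i = f i"
proof -
  have "\<exists>!h. h \<in> Hom C c y \<and> (\<forall>i\<in>I. h \<cdot> \<iota> i = f i)"
    using assms unfolding is_coproduct_def by blast
  then show ?thesis
    using that by blast
qed

lemma coproduct_ext:
  assumes "is_coproduct C I X c \<iota>" "h \<in> Hom C c y" "h' \<in> Hom C c y"
    and "\<And>i. i \<in> I \<Longrightarrow> h \<cdot> \<iota> i = h' \<cdot> \<iota> i"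
  shows "h = h'"
proof -
  have y: "y \<in> Obj C" using assms Hom_objD by blast
  have "\<forall>i\<in>I. h' \<cdot> \<iota> i \<in> Hom C (X i) y"
    using coproduct_Hom[OF assms(1)] Comp_Hom assms(3) by blast
  moreover have "\<forall>f. (\<forall>i\<in>I. f i \<in> Hom C (X i) y) \<longrightarrow> (\<exists>!h. h \<in> Hom C c y \<and> (\<forall>i\<in>I. h \<cdot> \<iota> i = f i))"
    using assms(1) y unfolding is_coproduct_def by blast
  ultimately have "\<exists>!h. h \<in> Hom C c y \<and> (\<forall>i\<in>I. h \<cdot> \<iota> i = h' \<cdot> \<iota> i)"
    by (elim allE[where x = "\<lambda>i. h' \<cdot> \<iota> i"]) blast
  then show ?thesis
    using assms(2-4) by blast
qed

lemma coproduct_retract: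
  assumes "is_coproduct C I X c \<iota>" "k \<in> I"
  shows "retract (X k) c"
proof -
  have o: "X i \<in> Obj C" if "i \<in> I" for i
    using assms(1) that by (auto simp: is_coproduct_def)
  \<comment> \<open>A coproduct comes without projections; the one onto \<open>X k\<close> is
    induced by the identity on \<open>X k\<close> and zero on the other summands.\<close>
  have "(if i = k then Ident C (X k) else Zero C (X i) (X k)) \<in> Hom C (X i) (X k)" if "i \<in> I" for i
    using o that assms(2) Ident_Hom Zero_Hom by auto
  then obtain p where p: "p \<in> Hom C c (X k)"
    "\<And>i. i \<in> I \<Longrightarrow> p \<cdot> \<iota> i = (if i = k then Ident C (X k) else Zero C (X i) (X k))"
    using coproduct_desc[OF assms(1) o[OF assms(2)], of "\<lambda>i. if i = k then Ident C (X k) else Zero C (X i) (X k)"]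
    by metis
  have "p \<cdot> \<iota> k = Ident C (X k)"
    using p(2)[OF assms(2)] by simp
  then show ?thesis
    using p(1) coproduct_Hom[OF assms] unfolding retract_def by blast
qed

text \<open>Compactness in a form that avoids finite sums of morphisms.\<close>

lemma compact_finite_support:
  fixes I U :: "'u set"
  assumes x: "x \<in> compact_objects C U" and I: "I \<prec> U" and cop: "is_coproduct C I X c \<iota>"
    and a: "a \<in> Hom C x c"
  obtains F where "finite F" "F \<subseteq> {i \<in> I. \<not> hom_vanishes C x (X i)}"
    "\<And>y q q'. \<lbrakk>q \<in> Hom C c y; q' \<in> Hom C c y; \<And>i. i \<in> F \<Longrightarrow> q \<cdot> \<iota> i = q' \<cdot> \<iota> i\<rbrakk> \<Longrightarrow> q \<cdot> a = q' \<cdot> a"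
proof -
  let ?G = "Defs.hom_group C x c"
  have xo: "x \<in> Obj C" using x by (simp add: compact_objects_def)
  have co: "c \<in> Obj C" using coproduct_Obj[OF cop] .
  have Xo: "X i \<in> Obj C" if "i \<in> I" for i
    using cop that by (auto simp: is_coproduct_def)
  interpret G: comm_group ?G using hom_group[OF xo co] .
  have "(\<lambda>f. gfinprod ?G (\<lambda>i. \<iota> i \<cdot> f i) I)
      \<in> Group.iso (sum_group I (\<lambda>i. Defs.hom_group C x (X i))) ?G"
    using x I cop by (auto simp: compact_objects_def)
  then have "(\<lambda>f. gfinprod ?G (\<lambda>i. \<iota> i \<cdot> f i) I) ` carrier (sum_group I (\<lambda>i. Defs.hom_group C x (X i)))
      = carrier ?G"
    by (simp add: Group.iso_def bij_betw_def)
  moreover have "a \<in> carrier ?G"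
    using a by (simp add: hom_group_def)
  ultimately obtain f where f: "f \<in> carrier (sum_group I (\<lambda>i. Defs.hom_group C x (X i)))"
    and af: "a = gfinprod ?G (\<lambda>i. \<iota> i \<cdot> f i) I"
    by (metis (no_types, lifting) imageE)
  have f': "f i \<in> Hom C x (X i)" if "i \<in> I" for i
    using f that carrier_sum_group[of I "\<lambda>i. Defs.hom_group C x (X i)"] group_hom[OF xo Xo]
    by (auto simp: hom_group_def)
  have fin: "finite {i \<in> I. f i \<noteq> Zero C x (X i)}"
    using f carrier_sum_group[of I "\<lambda>i. Defs.hom_group C x (X i)"] group_hom[OF xo Xo]
    by (auto simp: hom_group_def)
  \<comment> \<open>\<open>F\<close> is the support of the preimage \<open>f\<close> of
    \<open>a\<close> in the direct sum; \<open>A\<close> is the possibly smaller set of indices over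
    which \<open>gfinprod\<close> actually multiplies.\<close>
  define F where "F = {i \<in> I. f i \<noteq> Zero C x (X i)}"
  define A where "A = {i \<in> I. \<iota> i \<cdot> f i \<noteq> Zero C x c}"
  have AF: "A \<subseteq> F"
    using Comp_Zero_right[OF coproduct_Hom[OF cop] xo] by (auto simp: A_def F_def)
  have fc: "\<iota> i \<cdot> f i \<in> Hom C x c" if "i \<in> I" for i
    using Comp_Hom[OF f'[OF that] coproduct_Hom[OF cop that]] .
  have finA: "finite A"
    using finite_subset[OF AF] fin F_def by simp
  have a_eq: "a = finprod ?G (\<lambda>i. \<iota> i \<cdot> f i) A"
    using af finA unfolding gfinprod_def by (simp add: A_def hom_group_def)
  have sum_eq: "q \<cdot> finprod ?G (\<lambda>i. \<iota> i \<cdot> f i) B = q' \<cdot> finprod ?G (\<lambda>i. \<iota> i \<cdot> f i) B"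
    if q: "q \<in> Hom C c y" "q' \<in> Hom C c y" and agree: "\<And>i. i \<in> F \<Longrightarrow> q \<cdot> \<iota> i = q' \<cdot> \<iota> i"
      and "finite B" "B \<subseteq> F" for q q' y B
    using \<open>finite B\<close> \<open>B \<subseteq> F\<close>
  proof (induction B)
    case empty
    have "finprod ?G (\<lambda>i. \<iota> i \<cdot> f i) {} = \<one>\<^bsub>?G\<^esub>"
      by simp
    also have "\<dots> = Zero C x c"
      by (simp add: hom_group_def)
    finally have "finprod ?G (\<lambda>i. \<iota> i \<cdot> f i) {} = Zero C x c" .
    then show ?case
      using Comp_Zero_right[OF q(1) xo] Comp_Zero_right[OF q(2) xo] by simp
  next
    case (insert i B)
    let ?s = "finprod ?G (\<lambda>i. \<iota> i \<cdot> f i) B"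
    have BI: "B \<subseteq> I" "i \<in> I" using insert.prems by (auto simp: F_def)
    then have pc: "(\<lambda>i. \<iota> i \<cdot> f i) \<in> B \<rightarrow> carrier ?G" "\<iota> i \<cdot> f i \<in> carrier ?G"
      using fc by (auto simp: hom_group_def)
    have s: "?s \<in> Hom C x c"
      using G.finprod_closed[OF pc(1)] by (simp add: hom_group_def)
    have "finprod ?G (\<lambda>i. \<iota> i \<cdot> f i) (insert i B) = Plus C (\<iota> i \<cdot> f i) ?s"
      using G.finprod_insert[OF insert.hyps(1,2) pc] by (simp add: hom_group_def)
    moreover have "q \<cdot> \<iota> i = q' \<cdot> \<iota> i"
      using agree insert.prems by simp
    then have "q \<cdot> (\<iota> i \<cdot> f i) = q' \<cdot> (\<iota> i \<cdot> f i)"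
      using Comp_assoc[OF f'[OF BI(2)] coproduct_Hom[OF cop BI(2)]] q by metis
    ultimately show ?case
      using Comp_Plus_right[OF fc[OF BI(2)] s] q insert by simp
  qed
  have agree: "q \<cdot> a = q' \<cdot> a"
    if "q \<in> Hom C c y" "q' \<in> Hom C c y" "\<And>i. i \<in> F \<Longrightarrow> q \<cdot> \<iota> i = q' \<cdot> \<iota> i" for q q' y
    using sum_eq[OF that finA AF] a_eq by simp
  show ?thesis
  proof (rule that[of F])
    show "finite F"
      using fin by (simp add: F_def)
    show "F \<subseteq> {i \<in> I. \<not> hom_vanishes C x (X i)}"
      using f' hom_vanishesD by (auto simp: F_def)
    fix y q q'
    assume "q \<in> Hom C c y" "q' \<in> Hom C c y" "\<And>i. i \<in> F \<Longrightarrow> q \<cdot> \<iota> i = q' \<cdot> \<iota> i"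
    then show "q \<cdot> a = q' \<cdot> a"
      by (rule agree)
  qed
qed

text \<open>The support of any \<open>a\<close> is empty, so the identity and the zero endomorphism
  of \<open>c\<close> agree on it vacuously, hence agree after composition with
  \<open>a\<close>.\<close>

lemma hom_vanishes_coproduct:
  fixes I U :: "'u set"
  assumes "x \<in> compact_objects C U" "I \<prec> U" "is_coproduct C I X c \<iota>"
    and "\<And>i. i \<in> I \<Longrightarrow> hom_vanishes C x (X i)"
  shows "hom_vanishes C x c"
proof -
  have o: "x \<in> Obj C" "c \<in> Obj C"
    using assms(1) coproduct_Obj[OF assms(3)] by (auto simp: compact_objects_def)
  have "a = Zero C x c" if a: "a \<in> Hom C x c" for a
  proof -
    have "Ident C c \<cdot> a = Zero C c c \<cdot> a"
    proof (rule compact_finite_support[OF assms(1-3) a])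
      fix F
      assume "F \<subseteq> {i \<in> I. \<not> hom_vanishes C x (X i)}"
        and *: "\<And>y q q'. \<lbrakk>q \<in> Hom C c y; q' \<in> Hom C c y; \<And>i. i \<in> F \<Longrightarrow> q \<cdot> \<iota> i = q' \<cdot> \<iota> i\<rbrakk>
          \<Longrightarrow> q \<cdot> a = q' \<cdot> a"
      then have "F = {}" using assms(4) by blast
      then show "Ident C c \<cdot> a = Zero C c c \<cdot> a"
        using *[of "Ident C c" c "Zero C c c"] Ident_Hom Zero_Hom o by simp
    qed
    then show ?thesis
      using Comp_Ident_left[OF a] Comp_Zero_left[OF a o(2)] by simp
  qed
  then show ?thesis
    using hom_vanishes_iff o by blast
qed

end

section \<open>Exactness of distinguished triangles\<close>

context triangulated_category
begin

section \<open>The shift functor and its integer powers\<close>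

lemma ShiftO_Obj: "x \<in> Obj C \<Longrightarrow> ShiftO C x \<in> Obj C"
  using ShiftO_bij bij_betwE by blast

lemma ShiftM_Hom: "f \<in> Hom C x y \<Longrightarrow> ShiftM C f \<in> Hom C (ShiftO C x) (ShiftO C y)"
  using ShiftM_bij[of x y] Hom_objD[of f x y] bij_betwE by blast

lemma ShiftM_surj:
  assumes "f \<in> Hom C (ShiftO C x) (ShiftO C y)" "x \<in> Obj C" "y \<in> Obj C"
  obtains g where "g \<in> Hom C x y" "ShiftM C g = f"
proof -
  have "f \<in> ShiftM C ` Hom C x y"
    using bij_betw_imp_surj_on[OF ShiftM_bij[OF assms(2,3)]] assms(1) by simp
  then show ?thesis
    using that by auto
qed

lemma ShiftM_inject:
  assumes "f \<in> Hom C x y" "g \<in> Hom C x y" "ShiftM C f = ShiftM C g"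
  shows "f = g"
  using ShiftM_bij[of x y] Hom_objD[OF assms(1)] assms by (auto simp: bij_betw_def inj_on_def)

lemma ShiftM_Zero:
  assumes "x \<in> Obj C" "y \<in> Obj C"
  shows "ShiftM C (Zero C x y) = Zero C (ShiftO C x) (ShiftO C y)"
  using ShiftM_Plus[OF Zero_Hom Zero_Hom, OF assms assms] Plus_Zero_Zero[OF assms]
    Plus_self[OF ShiftM_Hom[OF Zero_Hom[OF assms]]] by simp

lemma hom_vanishes_ShiftO:
  assumes "x \<in> Obj C" "y \<in> Obj C"
  shows "hom_vanishes C (ShiftO C x) (ShiftO C y) \<longleftrightarrow> hom_vanishes C x y"
proof
  assume v: "hom_vanishes C (ShiftO C x) (ShiftO C y)"
  have "f = Zero C x y" if "f \<in> Hom C x y" for f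
    using hom_vanishesD[OF v ShiftM_Hom[OF that]] ShiftM_Zero[OF assms]
      ShiftM_inject[OF that Zero_Hom[OF assms]] by simp
  then show "hom_vanishes C x y"
    using assms hom_vanishes_iff by blast
next
  assume v: "hom_vanishes C x y"
  have "f = Zero C (ShiftO C x) (ShiftO C y)" if "f \<in> Hom C (ShiftO C x) (ShiftO C y)" for f
    using ShiftM_surj[OF that assms] hom_vanishesD[OF v] ShiftM_Zero[OF assms] by metis
  then show "hom_vanishes C (ShiftO C x) (ShiftO C y)"
    using assms ShiftO_Obj hom_vanishes_iff by blast
qed

lemma retract_ShiftO:
  assumes "retract x y"
  shows "retract (ShiftO C x) (ShiftO C y)"
proof -
  obtain i p where "i \<in> Hom C x y" "p \<in> Hom C y x" "p \<cdot> i = Ident C x"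
    using assms by (auto simp: retract_def)
  then have "ShiftM C p \<cdot> ShiftM C i = Ident C (ShiftO C x)"
    using ShiftM_Comp ShiftM_Ident Hom_objD by metis
  then show ?thesis
    using \<open>i \<in> _\<close> \<open>p \<in> _\<close> ShiftM_Hom unfolding retract_def by blast
qed

lemma retract_ShiftO_cancel:
  assumes "retract (ShiftO C x) (ShiftO C y)" "x \<in> Obj C" "y \<in> Obj C"
  shows "retract x y"
proof -
  obtain i p where ip: "i \<in> Hom C (ShiftO C x) (ShiftO C y)" "p \<in> Hom C (ShiftO C y) (ShiftO C x)"
    "p \<cdot> i = Ident C (ShiftO C x)"
    using assms by (auto simp: retract_def)
  obtain i' where i': "i' \<in> Hom C x y" "ShiftM C i' = i"
    using ShiftM_surj[OF ip(1) assms(2,3)] .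
  obtain p' where p': "p' \<in> Hom C y x" "ShiftM C p' = p"
    using ShiftM_surj[OF ip(2) assms(3,2)] .
  have "ShiftM C (p' \<cdot> i') = ShiftM C (Ident C x)"
    using ShiftM_Comp[OF i'(1) p'(1)] ShiftM_Ident[OF assms(2)] ip i' p' by simp
  then have "p' \<cdot> i' = Ident C x"
    using ShiftM_inject[OF Comp_Hom[OF i'(1) p'(1)] Ident_Hom[OF assms(2)]] by simp
  then show ?thesis
    using i' p' unfolding retract_def by blast
qed

abbreviation unshift :: "'a \<Rightarrow> 'a" where
  "unshift \<equiv> inv_into (Obj C) (ShiftO C)"

lemma unshift_Obj: "x \<in> Obj C \<Longrightarrow> unshift x \<in> Obj C"
  using ShiftO_bij bij_betw_inv_into bij_betwE by blast

lemma ShiftO_unshift: "x \<in> Obj C \<Longrightarrow> ShiftO C (unshift x) = x"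
  using ShiftO_bij by (simp add: bij_betw_inv_into_right)

lemma unshift_ShiftO: "x \<in> Obj C \<Longrightarrow> unshift (ShiftO C x) = x"
  using ShiftO_bij by (simp add: bij_betw_inv_into_left)

lemma shift_0 [simp]: "shift C 0 x = x"
  by (simp add: shift_def)

lemma shift_1: "shift C 1 x = ShiftO C x"
  by (simp add: shift_def)

lemma shift_Obj: "x \<in> Obj C \<Longrightarrow> shift C i x \<in> Obj C"
proof -
  assume x: "x \<in> Obj C"
  have "(ShiftO C ^^ n) x \<in> Obj C" "(unshift ^^ n) x \<in> Obj C" for n
    using x by (induction n) (auto simp: ShiftO_Obj unshift_Obj)
  then show ?thesis
    by (auto simp: shift_def)
qed

lemma ShiftO_shift:
  assumes "x \<in> Obj C"
  shows "ShiftO C (shift C i x) = shift C (i + 1) x"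
proof (cases "0 \<le> i")
  case True
  then show ?thesis
    by (simp add: shift_def nat_add_distrib)
next
  case False
  \<comment> \<open>The number of inverse shifts left after \<open>ShiftO\<close> has cancelled one.
    For \<open>i = -1\<close> it is 0, which matches the nonnegative branch of
    \<open>shift\<close>.\<close>
  define n where "n = nat (- (i + 1))"
  have "nat (- i) = Suc n" using False by (simp add: n_def)
  then have 1: "shift C i x = unshift ((unshift ^^ n) x)"
    using False by (simp add: shift_def)
  have 2: "shift C (i + 1) x = (unshift ^^ n) x"
    using False by (auto simp: shift_def n_def)
  show ?thesis
    using 1 2 ShiftO_unshift shift_Obj[OF assms, of "i + 1"] by simp
qed

lemma unshift_shift:
  assumes "x \<in> Obj C"
  shows "unshift (shift C i x) = shift C (i - 1) x"
  using ShiftO_shift[OF assms, of "i - 1"] unshift_ShiftO[OF shift_Obj[OF assms]] by (metis diff_add_cancel)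

lemma shift_shift:
  assumes "x \<in> Obj C"
  shows "shift C i (shift C j x) = shift C (i + j) x"
proof (induction i rule: int_induct[where k = 0])
  case base
  then show ?case by simp
next
  case (step1 i)
  then show ?case
    using ShiftO_shift[OF assms, of "i + j"] ShiftO_shift[OF shift_Obj[OF assms, of j], of i]
    by (simp add: ac_simps)
next
  case (step2 i)
  then show ?case
    using unshift_shift[OF assms, of "i + j"] unshift_shift[OF shift_Obj[OF assms, of j], of i]
    by (simp add: algebra_simps)
qed

lemma hom_vanishes_shift:
  assumes "x \<in> Obj C" "y \<in> Obj C"
  shows "hom_vanishes C (shift C i x) (shift C i y) \<longleftrightarrow> hom_vanishes C x y"
proof (induction i rule: int_induct[where k = 0])
  case base
  then show ?case by simp
next
  case (step1 i)
  then show ?case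
    using hom_vanishes_ShiftO[OF shift_Obj shift_Obj, OF assms, of i i]
    by (simp add: ShiftO_shift assms)
next
  case (step2 i)
  then show ?case
    using hom_vanishes_ShiftO[OF shift_Obj shift_Obj, OF assms, of "i - 1" "i - 1"]
    by (simp add: ShiftO_shift assms)
qed

lemma hom_vanishes_shift_right:
  assumes "x \<in> Obj C" "y \<in> Obj C"
  shows "hom_vanishes C (shift C i x) (shift C j y) \<longleftrightarrow> hom_vanishes C x (shift C (j - i) y)"
  using hom_vanishes_shift[OF assms(1) shift_Obj[OF assms(2)], of i "j - i"]
  by (simp add: shift_shift assms)

lemma hom_vanishes_shift_left:
  assumes "x \<in> Obj C" "y \<in> Obj C"
  shows "hom_vanishes C x (shift C i y) \<longleftrightarrow> hom_vanishes C (shift C (- i) x) y"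
  using hom_vanishes_shift_right[OF assms, of "- i" 0] by simp

lemma retract_shift:
  assumes "retract x y"
  shows "retract (shift C i x) (shift C i y)"
proof -
  have o: "x \<in> Obj C" "y \<in> Obj C"
    using assms Hom_objD by (auto simp: retract_def)
  show ?thesis
  proof (induction i rule: int_induct[where k = 0])
    case base
    then show ?case using assms by simp
  next
    case (step1 i)
    then show ?case
      using retract_ShiftO by (metis ShiftO_shift o)
  next
    case (step2 i)
    then show ?case
      using retract_ShiftO_cancel[of "shift C (i - 1) x" "shift C (i - 1) y"]
      by (simp add: ShiftO_shift o shift_Obj)
  qed
qed

lemma perp_iff:
  assumes "M \<in> Obj C"
  shows "y \<in> perp C M I \<longleftrightarrow> y \<in> Obj C \<and> (\<forall>i\<in>I. hom_vanishes C (shift C (- i) M) y)"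
  using hom_vanishes_shift_left[OF assms] by (auto simp: perp_def)

section \<open>Rotation and exactness of morphism groups along a triangle\<close>

lemma dist_triangleD:
  assumes "dist_triangle C x y z f g h"
  shows "f \<in> Hom C x y" "g \<in> Hom C y z" "h \<in> Hom C z (ShiftO C x)"
    "x \<in> Obj C" "y \<in> Obj C" "z \<in> Obj C"
  using assms Hom_objD unfolding dist_triangle_def is_triangle_def by blast+

lemma rotate:
  "dist_triangle C x y z f g h \<Longrightarrow>
    dist_triangle C y z (ShiftO C x) g h (neg (ShiftO C x) (ShiftO C y) (ShiftM C f))"
  using TR2 by (auto simp: dist_triangle_def)

text \<open>TR2 is an equivalence, so it can be read backwards. Because rotation introduces a sign,
  \<open>f'\<close> is chosen such that its shift is minus \<open>h\<close>.\<close>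

lemma rotate_back:
  assumes "dist_triangle C x y z f g h"
  obtains f' where "dist_triangle C (unshift z) x y f' f g"
proof -
  note D = dist_triangleD[OF assms]
  have s: "ShiftO C (unshift z) = z"
    using ShiftO_unshift D by simp
  have "neg z (ShiftO C x) h \<in> Hom C (ShiftO C (unshift z)) (ShiftO C x)"
    using neg_Hom[OF D(3)] s by simp
  then obtain f' where f': "f' \<in> Hom C (unshift z) x" "ShiftM C f' = neg z (ShiftO C x) h"
    using ShiftM_surj[OF _ unshift_Obj[OF D(6)] D(4)] by blast
  have "dist_triangle C (unshift z) x y f' f g"
    using TR2[of "unshift z" x y f' f g] assms D f' s neg_neg[OF D(3)]
    by (simp add: is_triangle_def)
  then show ?thesis
    using that by blast
qed

text \<open>Its rotation is the TR1 triangle on \<open>Ident C w\<close>, because the shift of a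
  zero object is again zero.\<close>

lemma dist_zero_left:
  assumes "zero_object C z" "w \<in> Obj C"
  shows "dist_triangle C z w w (Zero C z w) (Ident C w) (Zero C w (ShiftO C z))"
proof -
  have z: "z \<in> Obj C" using assms by (simp add: zero_object_def)
  have z': "zero_object C (ShiftO C z)"
    using assms(1) z zero_object_iff hom_vanishes_ShiftO ShiftO_Obj by simp
  have "neg (ShiftO C z) (ShiftO C w) (ShiftM C (Zero C z w)) = Zero C (ShiftO C z) (ShiftO C w)"
    using ShiftM_Zero[OF z assms(2)] neg_Zero ShiftO_Obj z assms(2) by simp
  then show ?thesis
    using TR2[of z w w "Zero C z w" "Ident C w" "Zero C w (ShiftO C z)"] TR1_Ident[OF assms(2) z']
      Zero_Hom Ident_Hom ShiftO_Obj z assms(2) by (simp add: is_triangle_def)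
qed

text \<open>Comparison with the triangle on \<open>Ident C x\<close> by TR3 makes
  \<open>g \<cdot> f\<close> factor through a zero object.\<close>

lemma dist_comp_zero:
  assumes "dist_triangle C x y z f g h"
  shows "g \<cdot> f = Zero C x z"
proof -
  note D = dist_triangleD[OF assms]
  obtain o' where o: "zero_object C o'" using ex_zero_object by blast
  have "f \<cdot> Ident C x = f \<cdot> Ident C x" by simp
  then obtain c where "c \<in> Hom C o' z" "c \<cdot> Zero C x o' = g \<cdot> f"
    using TR3[OF TR1_Ident[OF D(4) o] assms Ident_Hom[OF D(4)] D(1)] by blast
  then show ?thesis
    using Comp_Zero_right D(4) by metis
qed

text \<open>A fill-in towards the triangle 0 -> w -> w, with \<open>a\<close> in the middle, is
  exactly the required factorization.\<close>

lemma exact_contravariant: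
  assumes "dist_triangle C x y z f g h" "a \<in> Hom C y w" "a \<cdot> f = Zero C x w"
  obtains b where "b \<in> Hom C z w" "a = b \<cdot> g"
proof -
  note D = dist_triangleD[OF assms(1)]
  have w: "w \<in> Obj C" using assms Hom_objD by blast
  obtain o' where o: "zero_object C o'" using ex_zero_object by blast
  have o': "o' \<in> Obj C" using o by (simp add: zero_object_def)
  have "a \<cdot> f = Zero C o' w \<cdot> Zero C x o'"
    using assms(3) Comp_Zero_left[OF Zero_Hom w] D o' by simp
  then obtain c where "c \<in> Hom C z w" "c \<cdot> g = Ident C w \<cdot> a"
    using TR3[OF assms(1) dist_zero_left[OF o w] Zero_Hom[OF D(4) o'] assms(2)] by blast
  then show ?thesis
    using that Comp_Ident_left[OF assms(2)] by metis
qed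

text \<open>TR3 supplies only a third morphism, so both triangles are rotated until the wanted first
  morphism becomes the third, and the fill-in is then unshifted.\<close>

lemma exact_middle:
  assumes "dist_triangle C x y z f g h" "a \<in> Hom C w y" "g \<cdot> a = Zero C w z"
  obtains b where "b \<in> Hom C w x" "a = f \<cdot> b"
proof -
  note D = dist_triangleD[OF assms(1)]
  have w: "w \<in> Obj C" using assms Hom_objD by blast
  obtain o' where o: "zero_object C o'" using ex_zero_object by blast
  have o': "o' \<in> Obj C" using o by (simp add: zero_object_def)
  let ?n = "neg (ShiftO C x) (ShiftO C y) (ShiftM C f)"
  let ?i = "neg (ShiftO C w) (ShiftO C w) (ShiftM C (Ident C w))"
  have t1: "dist_triangle C w o' (ShiftO C w) (Zero C w o') (Zero C o' (ShiftO C w)) ?i"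
    using rotate[OF TR1_Ident[OF w o]] .
  have "Zero C o' z \<cdot> Zero C w o' = g \<cdot> a"
    using assms(3) Comp_Zero_left[OF Zero_Hom[OF w o'] D(6)] by simp
  then obtain c where c: "c \<in> Hom C (ShiftO C w) (ShiftO C x)" "ShiftM C a \<cdot> ?i = ?n \<cdot> c"
    using TR3[OF t1 rotate[OF assms(1)] assms(2) Zero_Hom[OF o' D(6)]] by blast
  obtain b where b: "b \<in> Hom C w x" "ShiftM C b = c"
    using ShiftM_surj[OF c(1) w D(4)] .
  have I: "Ident C (ShiftO C w) \<in> Hom C (ShiftO C w) (ShiftO C w)"
    using Ident_Hom ShiftO_Obj w by blast
  have fc: "ShiftM C f \<cdot> c \<in> Hom C (ShiftO C w) (ShiftO C y)"
    using Comp_Hom[OF c(1) ShiftM_Hom[OF D(1)]] .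
  \<comment> \<open>Rotation put a sign on both sides of the square; the two cancel.\<close>
  have "neg (ShiftO C w) (ShiftO C y) (ShiftM C a) = neg (ShiftO C w) (ShiftO C y) (ShiftM C f \<cdot> c)"
    using c(2) Comp_neg_right[OF I ShiftM_Hom[OF assms(2)]] Comp_neg_left[OF c(1) ShiftM_Hom[OF D(1)]]
      ShiftM_Ident[OF w] Comp_Ident_right[OF ShiftM_Hom[OF assms(2)]] by simp
  then have "ShiftM C a = ShiftM C f \<cdot> c"
    using neg_neg[OF fc] neg_neg[OF ShiftM_Hom[OF assms(2)]] by metis
  then have "ShiftM C a = ShiftM C (f \<cdot> b)"
    using ShiftM_Comp[OF b(1) D(1)] b(2) by simp
  then have "a = f \<cdot> b"
    using ShiftM_inject[OF assms(2) Comp_Hom[OF b(1) D(1)]] by simp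
  then show ?thesis
    using that b(1) by blast
qed

lemma vanishes_middle:
  assumes "dist_triangle C x y z f g h" "hom_vanishes C w x" "hom_vanishes C w z" "w \<in> Obj C"
  shows "hom_vanishes C w y"
proof -
  note D = dist_triangleD[OF assms(1)]
  have "a = Zero C w y" if a: "a \<in> Hom C w y" for a
  proof -
    obtain b where "b \<in> Hom C w x" "a = f \<cdot> b"
      using exact_middle[OF assms(1) a] hom_vanishesD[OF assms(3) Comp_Hom[OF a D(2)]] by blast
    then show ?thesis
      using hom_vanishesD[OF assms(2)] Comp_Zero_right[OF D(1) assms(4)] by simp
  qed
  then show ?thesis
    using hom_vanishes_iff assms(4) D by blast
qed

lemma vanishes_middle_contravariant:
  assumes "dist_triangle C x y z f g h" "hom_vanishes C x w" "hom_vanishes C z w" "w \<in> Obj C"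
  shows "hom_vanishes C y w"
proof -
  note D = dist_triangleD[OF assms(1)]
  have "a = Zero C y w" if a: "a \<in> Hom C y w" for a
  proof -
    obtain b where "b \<in> Hom C z w" "a = b \<cdot> g"
      using exact_contravariant[OF assms(1) a] hom_vanishesD[OF assms(2) Comp_Hom[OF D(1) a]] by blast
    then show ?thesis
      using hom_vanishesD[OF assms(3)] Comp_Zero_left[OF D(2) assms(4)] by simp
  qed
  then show ?thesis
    using hom_vanishes_iff assms(4) D by blast
qed

lemma surj_on_hom:
  assumes "dist_triangle C x y z f g h" "hom_vanishes C w (ShiftO C x)" "a \<in> Hom C w z"
  obtains b where "b \<in> Hom C w y" "a = g \<cdot> b"
  using exact_middle[OF rotate[OF assms(1)] assms(3)]
    hom_vanishesD[OF assms(2) Comp_Hom[OF assms(3) dist_triangleD(3)[OF assms(1)]]] that by blast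

lemma inj_on_hom:
  assumes "dist_triangle C x y z f g h" "hom_vanishes C (ShiftO C w) z"
    "a \<in> Hom C w x" "f \<cdot> a = Zero C w y"
  shows "a = Zero C w x"
proof -
  note D = dist_triangleD[OF assms(1)]
  have w: "w \<in> Obj C" using assms Hom_objD by blast
  obtain f' where f': "dist_triangle C (unshift z) x y f' f g"
    using rotate_back[OF assms(1)] .
  have v: "hom_vanishes C w (unshift z)"
    using hom_vanishes_ShiftO[OF w unshift_Obj[OF D(6)]] assms(2) ShiftO_unshift[OF D(6)] by simp
  obtain b where "b \<in> Hom C w (unshift z)" "a = f' \<cdot> b"
    using exact_middle[OF f' assms(3,4)] .
  then show ?thesis
    using hom_vanishesD[OF v] Comp_Zero_right[OF dist_triangleD(1)[OF f'] w] by simp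
qed

text \<open>The image \<open>h \<cdot> a\<close> is the shift of some \<open>b\<close>, and
  \<open>f \<cdot> b\<close> vanishes because \<open>ShiftM C f \<cdot> h\<close> does. Injectivity
  kills \<open>b\<close>, which removes the obstruction to lifting \<open>a\<close> along
  \<open>g\<close>.\<close>

lemma inj_imp_connecting_zero:
  assumes "dist_triangle C x y z f g h"
    and "\<And>a. a \<in> Hom C w x \<Longrightarrow> f \<cdot> a = Zero C w y \<Longrightarrow> a = Zero C w x"
    and "a \<in> Hom C (ShiftO C w) z" "w \<in> Obj C"
  obtains b where "b \<in> Hom C (ShiftO C w) y" "a = g \<cdot> b"
proof -
  note D = dist_triangleD[OF assms(1)]
  have ha: "h \<cdot> a \<in> Hom C (ShiftO C w) (ShiftO C x)"
    using Comp_Hom[OF assms(3) D(3)] .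
  obtain b where b: "b \<in> Hom C w x" "ShiftM C b = h \<cdot> a"
    using ShiftM_surj[OF ha assms(4) D(4)] .
  have "neg (ShiftO C x) (ShiftO C y) (ShiftM C f) \<cdot> h = Zero C z (ShiftO C y)"
    using dist_comp_zero[OF rotate[OF rotate[OF assms(1)]]] .
  then have "neg z (ShiftO C y) (ShiftM C f \<cdot> h) = Zero C z (ShiftO C y)"
    using Comp_neg_left[OF D(3) ShiftM_Hom[OF D(1)]] by simp
  then have "ShiftM C f \<cdot> h = Zero C z (ShiftO C y)"
    using neg_neg[OF Comp_Hom[OF D(3) ShiftM_Hom[OF D(1)]]] neg_Zero[OF D(6) ShiftO_Obj[OF D(5)]] by simp
  then have "ShiftM C f \<cdot> (h \<cdot> a) = Zero C (ShiftO C w) (ShiftO C y)"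
    using Comp_assoc[OF assms(3) D(3) ShiftM_Hom[OF D(1)]] Comp_Zero_left[OF assms(3) ShiftO_Obj[OF D(5)]]
    by simp
  then have "ShiftM C (f \<cdot> b) = ShiftM C (Zero C w y)"
    using ShiftM_Comp[OF b(1) D(1)] b(2) ShiftM_Zero[OF assms(4) D(5)] by simp
  then have "f \<cdot> b = Zero C w y"
    using ShiftM_inject[OF Comp_Hom[OF b(1) D(1)] Zero_Hom[OF assms(4) D(5)]] by simp
  then have "b = Zero C w x"
    using assms(2) b(1) by blast
  then have "h \<cdot> a = Zero C (ShiftO C w) (ShiftO C x)"
    using b(2) ShiftM_Zero[OF assms(4) D(4)] by simp
  then show ?thesis
    using exact_middle[OF rotate[OF assms(1)] assms(3)] that by blast
qed

text \<open>Injectivity on maps from \<open>w\<close> lifts a map into the cone to \<open>y\<close>;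
  surjectivity on maps from \<open>ShiftO C w\<close> moves it on to \<open>x\<close>, where
  \<open>g \<cdot> f\<close> kills it.\<close>

lemma vanishes_cone:
  assumes "dist_triangle C x y z f g h"
    and "\<And>a. a \<in> Hom C w x \<Longrightarrow> f \<cdot> a = Zero C w y \<Longrightarrow> a = Zero C w x"
    and "\<And>b. b \<in> Hom C (ShiftO C w) y \<Longrightarrow> \<exists>a \<in> Hom C (ShiftO C w) x. b = f \<cdot> a"
    and "w \<in> Obj C"
  shows "hom_vanishes C (ShiftO C w) z"
proof -
  note D = dist_triangleD[OF assms(1)]
  have "c = Zero C (ShiftO C w) z" if c: "c \<in> Hom C (ShiftO C w) z" for c
  proof -
    obtain b where b: "b \<in> Hom C (ShiftO C w) y" "c = g \<cdot> b"
      using inj_imp_connecting_zero[OF assms(1,2) c assms(4)] by blast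
    obtain a where a: "a \<in> Hom C (ShiftO C w) x" "b = f \<cdot> a"
      using assms(3)[OF b(1)] by blast
    show ?thesis
      using a b dist_comp_zero[OF assms(1)] Comp_assoc[OF a(1) D(1,2)] Comp_Zero_left[OF a(1) D(6)] by simp
  qed
  then show ?thesis
    using hom_vanishes_iff assms(4) ShiftO_Obj D by blast
qed

section \<open>Thick subcategories cut out by vanishing conditions\<close>

lemma hom_bounded_thick:
  assumes "t \<in> Obj C"
  shows "thick C {x \<in> Obj C. hom_bounded C x t}"
proof -
  have sh: "hom_bounded C (shift C i x) t" if x: "x \<in> Obj C" "hom_bounded C x t" for x i
  proof -
    obtain N where N: "\<And>n. \<bar>n\<bar> > N \<Longrightarrow> hom_vanishes C x (shift C n t)"
      using x(2) by (auto simp: hom_bounded_def)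
    have "hom_vanishes C (shift C i x) (shift C n t)" if "\<bar>n\<bar> > N + \<bar>i\<bar>" for n
      using N[of "n - i"] that hom_vanishes_shift_right[OF x(1) assms] by auto
    then show ?thesis
      unfolding hom_bounded_def by blast
  qed
  have tr: "hom_bounded C z t" if tri: "dist_triangle C x y z f g h"
    and hb: "hom_bounded C x t" "hom_bounded C y t" for x y z f g h
  proof -
    note D = dist_triangleD[OF tri]
    obtain N1 where N1: "\<And>n. \<bar>n\<bar> > N1 \<Longrightarrow> hom_vanishes C (shift C 1 x) (shift C n t)"
      using sh[OF D(4) hb(1), of 1] by (auto simp: hom_bounded_def)
    obtain N2 where N2: "\<And>n. \<bar>n\<bar> > N2 \<Longrightarrow> hom_vanishes C y (shift C n t)"
      using hb(2) by (auto simp: hom_bounded_def)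
    \<comment> \<open>\<open>z\<close> sits between \<open>y\<close> and \<open>x[1]\<close> in the
      rotated triangle, so the larger of their bounds serves for it.\<close>
    have "hom_vanishes C z (shift C n t)" if "\<bar>n\<bar> > max N1 N2" for n
      using vanishes_middle_contravariant[OF rotate[OF tri] _ _ shift_Obj[OF assms]]
        N1[of n] N2[of n] that by (simp add: shift_1)
    then show ?thesis
      unfolding hom_bounded_def by blast
  qed
  have su: "x \<in> Obj C \<and> hom_bounded C x t" if "direct_summand C x s" "hom_bounded C s t" for x s
  proof -
    have r: "retract x s" using that(1) direct_summand_retract by blast
    then have "x \<in> Obj C" using Hom_objD unfolding retract_def by blast
    moreover have "hom_vanishes C x (shift C n t)" if "hom_vanishes C s (shift C n t)" for n
      using hom_vanishes_retract[OF r retract_refl[OF shift_Obj[OF assms]] that] .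
    ultimately show ?thesis
      using that(2) unfolding hom_bounded_def by blast
  qed
  have "hom_bounded C z t" if "zero_object C z" for z
    using hom_vanishes_zero_object(2)[OF that shift_Obj[OF assms]] unfolding hom_bounded_def by blast
  then show ?thesis
    unfolding thick_def using sh tr su shift_Obj dist_triangleD(6) by (auto simp: zero_object_def)
qed

lemma left_orthogonal_thick:
  assumes "t \<in> Obj C"
  shows "thick C {x \<in> Obj C. \<forall>n. hom_vanishes C x (shift C n t)}"
proof -
  have sh: "hom_vanishes C (shift C i x) (shift C n t)"
    if x: "x \<in> Obj C" "\<forall>n. hom_vanishes C x (shift C n t)" for x i n
    using hom_vanishes_shift_right[OF x(1) assms] x(2) by simp
  have tr: "hom_vanishes C z (shift C n t)"
    if "dist_triangle C x y z f g h" "\<forall>n. hom_vanishes C x (shift C n t)"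
      "\<forall>n. hom_vanishes C y (shift C n t)" for x y z f g h n
    using vanishes_middle_contravariant[OF rotate[OF that(1)] _ _ shift_Obj[OF assms]] that(3)
      sh[OF dist_triangleD(4)[OF that(1)] that(2), of 1] by (simp add: shift_1)
  have su: "x \<in> Obj C \<and> (\<forall>n. hom_vanishes C x (shift C n t))"
    if "direct_summand C x s" "\<forall>n. hom_vanishes C s (shift C n t)" for x s
  proof -
    have r: "retract x s" using that(1) direct_summand_retract by blast
    then have "x \<in> Obj C" using Hom_objD unfolding retract_def by blast
    then show ?thesis
      using hom_vanishes_retract[OF r retract_refl[OF shift_Obj[OF assms]]] that(2) by blast
  qed
  show ?thesis
    unfolding thick_def using sh tr su shift_Obj dist_triangleD(6)
      hom_vanishes_zero_object(2)[OF _ shift_Obj[OF assms]] by (auto simp: zero_object_def)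
qed

lemma thick_shift:
  assumes "thick C S" "x \<in> S"
  shows "shift C i x \<in> S"
proof -
  have o: "x \<in> Obj C" using assms by (auto simp: thick_def)
  show ?thesis
  proof (induction i rule: int_induct[where k = 0])
    case base
    then show ?case using assms by simp
  next
    case (step1 i)
    then have "shift C 1 (shift C i x) \<in> S" using assms(1) by (simp add: thick_def)
    then show ?case using shift_shift[OF o] by (simp add: add.commute)
  next
    case (step2 i)
    then have "shift C (- 1) (shift C i x) \<in> S" using assms(1) by (simp add: thick_def)
    then show ?case using shift_shift[OF o] by simp
  qed
qed

end

section \<open>Homotopy colimits\<close>

context compactly_generated_category
begin

section \<open>Small sets and countable coproducts\<close>

lemma countable_small: "countable (I :: 'i set) \<Longrightarrow> I \<prec> U"
proof -
  assume I: "countable I"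
  have inf: "infinite U" using uncountable_U countable_finite by blast
  have "I \<lesssim> U"
  proof -
    have "I \<lesssim> (UNIV :: nat set)" using I by (auto simp: countable_def lepoll_def)
    also have "(UNIV :: nat set) \<lesssim> U" using inf infinite_le_lepoll by blast
    finally show ?thesis .
  qed
  moreover have "\<not> I \<approx> U" 
    using I uncountable_U countable_eqpoll eqpoll_sym by blast
  ultimately show ?thesis
    by (simp add: lesspoll_def)
qed

text \<open>Index sets have to live in the type of \<open>U\<close>, so the coproduct is formed over
  a copy \<open>range e\<close> of the naturals and reindexed. Compactness is recorded in the form
  that homotopy colimits need: an endomorphism of \<open>c\<close> that fixes enough initial
  summands fixes \<open>a\<close>.\<close>

lemma countable_coproduct:
  fixes X :: "nat \<Rightarrow> 'o"
  assumes "\<And>n. X n \<in> Obj C"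
  obtains c \<iota> where "is_coproduct C UNIV X c \<iota>"
    "\<forall>x \<in> compact_objects C U. (\<forall>n. hom_vanishes C x (X n)) \<longrightarrow> hom_vanishes C x c"
    "\<forall>x \<in> compact_objects C U. \<forall>a \<in> Hom C x c.
      \<exists>k :: nat. \<forall>q \<in> Hom C c c. (\<forall>n<k. q \<cdot> \<iota> n = \<iota> n) \<longrightarrow> q \<cdot> a = a"
proof -
  have "infinite U" using uncountable_U countable_finite by blast
  then obtain e :: "nat \<Rightarrow> 'u" where e: "inj e"
    using infinite_countable_subset by blast
  let ?I = "range e"
  let ?X = "\<lambda>u. X (inv_into UNIV e u)"
  have I: "?I \<prec> U" by (rule countable_small) simp
  obtain c \<kappa> where cop: "is_coproduct C ?I ?X c \<kappa>"
    using small_coproducts[OF I, of ?X] assms by auto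
  define \<iota> where "\<iota> = (\<lambda>n. \<kappa> (e n))"
  have inv: "inv_into UNIV e (e n) = n" for n using e by simp
  have co: "c \<in> Obj C" using coproduct_Obj[OF cop] .
  have "is_coproduct C UNIV X c \<iota>"
  proof -
    have "\<exists>!h. h \<in> Hom C c y \<and> (\<forall>n. h \<cdot> \<iota> n = f n)"
      if y: "y \<in> Obj C" and f: "\<forall>n. f n \<in> Hom C (X n) y" for y f
    proof (rule ex_ex1I)
      obtain h where "h \<in> Hom C c y" "\<And>u. u \<in> ?I \<Longrightarrow> h \<cdot> \<kappa> u = f (inv_into UNIV e u)"
        using coproduct_desc[OF cop y, of "\<lambda>u. f (inv_into UNIV e u)"] f by blast
      then show "\<exists>h. h \<in> Hom C c y \<and> (\<forall>n. h \<cdot> \<iota> n = f n)"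
        by (auto simp: \<iota>_def inv)
      show "h = h'" if "h \<in> Hom C c y \<and> (\<forall>n. h \<cdot> \<iota> n = f n)" "h' \<in> Hom C c y \<and> (\<forall>n. h' \<cdot> \<iota> n = f n)"
        for h h'
        using coproduct_ext[OF cop, of h y h'] that by (fastforce simp: \<iota>_def)
    qed
    then show ?thesis
      using assms co coproduct_Hom[OF cop, of "e _"] by (auto simp: is_coproduct_def \<iota>_def inv)
  qed
  moreover have "hom_vanishes C x c" if "x \<in> compact_objects C U" "\<And>n. hom_vanishes C x (X n)" for x
    using hom_vanishes_coproduct[OF that(1) I cop] that(2) by blast
  moreover have "\<exists>k :: nat. \<forall>q \<in> Hom C c c. (\<forall>n<k. q \<cdot> \<iota> n = \<iota> n) \<longrightarrow> q \<cdot> a = a"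
    if x: "x \<in> compact_objects C U" and a: "a \<in> Hom C x c" for x a
  proof (rule compact_finite_support[OF x I cop a])
    fix F
    assume F: "finite F" "F \<subseteq> {i \<in> ?I. \<not> hom_vanishes C x (X (inv_into UNIV e i))}"
      and *: "\<And>y q q'. \<lbrakk>q \<in> Hom C c y; q' \<in> Hom C c y; \<And>i. i \<in> F \<Longrightarrow> q \<cdot> \<kappa> i = q' \<cdot> \<kappa> i\<rbrakk>
        \<Longrightarrow> q \<cdot> a = q' \<cdot> a"
    obtain k where k: "\<forall>n \<in> inv_into UNIV e ` F. n < k"
      using finite_nat_set_iff_bounded F(1) by blast
    have "q \<cdot> a = a" if q: "q \<in> Hom C c c" "\<forall>n<k. q \<cdot> \<iota> n = \<iota> n" for q
    proof -
      have "q \<cdot> a = Ident C c \<cdot> a"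
      proof (rule *[OF q(1) Ident_Hom[OF co]])
        fix i assume i: "i \<in> F"
        then have "i = e (inv_into UNIV e i)" "inv_into UNIV e i < k"
          using F(2) k by (auto simp: inv)
        then have "q \<cdot> \<kappa> i = \<kappa> i"
          using q(2) by (metis \<iota>_def)
        then show "q \<cdot> \<kappa> i = Ident C c \<cdot> \<kappa> i"
          using Comp_Ident_left coproduct_Hom[OF cop] i F(2) by (metis (no_types, lifting) mem_Collect_eq subsetD)
      qed
      then show ?thesis
        using Comp_Ident_left[OF a] by simp
    qed
    then show ?thesis by blast
  qed
  ultimately show ?thesis
    using that[of c \<iota>] by simp
qed

text \<open>
  \<open>Q\<close> is the homotopy colimit of the sequence, that is, the cone of \<open>1 - s\<close> on the coproduct
  of the \<open>X n\<close>, where \<open>s\<close> is the shift along the \<open>f n\<close>.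
\<close>

lemma homotopy_colimit:
  fixes X :: "nat \<Rightarrow> 'o"
  assumes X: "\<And>n. X n \<in> Obj C" and f: "\<And>n. f n \<in> Hom C (X n) (X (Suc n))"
  obtains Q g where "\<And>n. g n \<in> Hom C (X n) Q" "\<And>n. g (Suc n) \<cdot> f n = g n"
    "\<And>y u. \<lbrakk>\<And>n. u n \<in> Hom C (X n) y; \<And>n. u (Suc n) \<cdot> f n = u n\<rbrakk>
      \<Longrightarrow> \<exists>v \<in> Hom C Q y. \<forall>n. v \<cdot> g n = u n"
    "\<And>w a. \<lbrakk>w \<in> compact_objects C U; ShiftO C w \<in> compact_objects C U; a \<in> Hom C (ShiftO C w) Q\<rbrakk>
      \<Longrightarrow> \<exists>n. \<exists>b \<in> Hom C (ShiftO C w) (X n). a = g n \<cdot> b"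
    "\<And>w b. \<lbrakk>w \<in> compact_objects C U; \<And>n. b n \<in> Hom C w (X n); \<And>n. b (Suc n) = f n \<cdot> b n;
      g 0 \<cdot> b 0 = Zero C w Q\<rbrakk> \<Longrightarrow> \<exists>k. b k = Zero C w (X k)"
proof -
  obtain c \<iota> where cop: "is_coproduct C UNIV X c \<iota>"
    and support: "\<forall>x \<in> compact_objects C U. \<forall>a \<in> Hom C x c.
      \<exists>k :: nat. \<forall>q \<in> Hom C c c. (\<forall>n<k. q \<cdot> \<iota> n = \<iota> n) \<longrightarrow> q \<cdot> a = a"
    using countable_coproduct[of X, OF X] by metis
  have co: "c \<in> Obj C" using coproduct_Obj[OF cop] .
  have \<iota>: "\<iota> n \<in> Hom C (X n) c" for n using coproduct_Hom[OF cop] by simp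
  note ext = coproduct_ext[OF cop]
  have \<iota>f: "\<iota> (Suc n) \<cdot> f n \<in> Hom C (X n) c" for n
    using Comp_Hom[OF f \<iota>] .
  obtain s where s: "s \<in> Hom C c c" "\<And>n. s \<cdot> \<iota> n = \<iota> (Suc n) \<cdot> f n"
    using coproduct_desc[OF cop co, of "\<lambda>n. \<iota> (Suc n) \<cdot> f n"] \<iota>f by auto
  have I: "Ident C c \<in> Hom C c c" using Ident_Hom[OF co] .
  define d where "d = Plus C (Ident C c) (neg c c s)"
  have d: "d \<in> Hom C c c" using Plus_Hom[OF I neg_Hom[OF s(1)]] by (simp add: d_def)
  have d_left: "d \<cdot> a = Plus C a (neg w c (s \<cdot> a))" if "a \<in> Hom C w c" for w a
    using diff_Comp[OF that I s(1)] Comp_Ident_left[OF that] by (simp add: d_def)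
  have d_right: "a \<cdot> d = Plus C a (neg c y (a \<cdot> s))" if "a \<in> Hom C c y" for y a
    using Comp_diff[OF I s(1) that] Comp_Ident_right[OF that] by (simp add: d_def)
  obtain Q g' h where tri: "dist_triangle C c c Q d g' h"
    using TR1_cone[OF d] by blast
  have g': "g' \<in> Hom C c Q" and Qo: "Q \<in> Obj C" using dist_triangleD[OF tri] by auto
  define g where "g = (\<lambda>n. g' \<cdot> \<iota> n)"
  have g: "g n \<in> Hom C (X n) Q" for n using Comp_Hom[OF \<iota> g'] by (simp add: g_def)
  have "Plus C g' (neg c Q (g' \<cdot> s)) = Zero C c Q"
    using d_right[OF g'] dist_comp_zero[OF tri] by simp
  then have g's: "g' \<cdot> s = g'"
    using Plus_neg_eq_Zero_iff[OF g' Comp_Hom[OF s(1) g']] by simp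
  have compat: "g (Suc n) \<cdot> f n = g n" for n
    using Comp_assoc[OF f \<iota> g'] Comp_assoc[OF \<iota> s(1) g'] s(2) g's by (simp add: g_def)
  \<comment> \<open>\<open>T n k\<close> is the composite of transition maps from \<open>X n\<close>
    to \<open>X k\<close>. For \<open>k < n\<close> it is a dummy identity, excluded from every use
    by \<open>n \<le> k\<close>.\<close>
  define T where "T = (\<lambda>n. rec_nat (Ident C (X 0)) (\<lambda>k t. if n \<le> k then f k \<cdot> t else Ident C (X (Suc k))))"
  have T_self: "T n n = Ident C (X n)" for n by (cases n) (auto simp: T_def)
  have T_Suc: "T n (Suc k) = f k \<cdot> T n k" if "n \<le> k" for n k
    using that by (simp add: T_def)
  have T: "T n k \<in> Hom C (X n) (X k)" if "n \<le> k" for n k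
    using that
  proof (induction k rule: dec_induct)
    case base
    then show ?case using T_self Ident_Hom X by simp
  next
    case (step k)
    then show ?case using T_Suc Comp_Hom f by simp
  qed
  have T_left: "T n k = T (Suc n) k \<cdot> f n" if "Suc n \<le> k" for n k
    using that
  proof (induction k rule: dec_induct)
    case base
    then show ?case
      using T_Suc[of n n] T_self Comp_Ident_left[OF f] Comp_Ident_right[OF f] by simp
  next
    case (step k)
    then show ?case
      using T_Suc[of n k] T_Suc[of "Suc n" k] Comp_assoc[OF f T f, of n k] by simp
  qed
  have gT: "g k \<cdot> T n k = g n" if "n \<le> k" for n k
    using that
  proof (induction k rule: dec_induct)
    case base
    then show ?case using T_self Comp_Ident_right[OF g] by simp
  next
    case (step k)
    then show ?case using T_Suc compat Comp_assoc[OF T f g, of n k] by simp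
  qed
  \<comment> \<open>\<open>r k\<close> collapses the summands \<open>0..k\<close> onto
    \<open>X k\<close> along the transition maps.\<close>
  have "\<exists>r. r \<in> Hom C c (X k) \<and> (\<forall>n. r \<cdot> \<iota> n = (if n \<le> k then T n k else Zero C (X n) (X k)))" for k
    using coproduct_desc[OF cop X, of "\<lambda>n. if n \<le> k then T n k else Zero C (X n) (X k)"]
      T Zero_Hom X by (metis (no_types, lifting) UNIV_I)
  then obtain r where r: "\<And>k. r k \<in> Hom C c (X k)" "\<And>k n. n \<le> k \<Longrightarrow> r k \<cdot> \<iota> n = T n k"
    by metis
  \<comment> \<open>\<open>q k\<close> projects \<open>c\<close> onto its first \<open>k\<close>
    summands; by compactness every morphism from a compact object to \<open>c\<close> is fixed by
    some \<open>q k\<close>.\<close>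
  have "\<exists>q. q \<in> Hom C c c \<and> (\<forall>n. q \<cdot> \<iota> n = (if n < k then \<iota> n else Zero C (X n) c))" for k
    using coproduct_desc[OF cop co, of "\<lambda>n. if n < k then \<iota> n else Zero C (X n) c"]
      \<iota> Zero_Hom[OF X co] by (metis (no_types, lifting) UNIV_I)
  then obtain q where q: "\<And>k. q k \<in> Hom C c c"
    and q\<iota>: "\<And>k n. q k \<cdot> \<iota> n = (if n < k then \<iota> n else Zero C (X n) c)"
    by metis
  have support': "\<exists>k. q k \<cdot> a = a" if "x \<in> compact_objects C U" "a \<in> Hom C x c" for x a
    using bspec[OF bspec[OF support that(1)] that(2)] q q\<iota> by (metis (no_types, lifting))
  have universal: "\<exists>v \<in> Hom C Q y. \<forall>n. v \<cdot> g n = u n"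
    if u: "\<And>n. u n \<in> Hom C (X n) y" and uf: "\<And>n. u (Suc n) \<cdot> f n = u n" for y u
  proof -
    have y: "y \<in> Obj C" using u[of 0] Hom_objD by blast
    obtain e where e: "e \<in> Hom C c y" "\<And>n. e \<cdot> \<iota> n = u n"
      using coproduct_desc[OF cop y, of u] u by auto
    have "e \<cdot> s = e"
    proof (rule ext[OF Comp_Hom[OF s(1) e(1)] e(1)])
      fix n
      show "(e \<cdot> s) \<cdot> \<iota> n = e \<cdot> \<iota> n"
        using Comp_assoc[OF \<iota> s(1) e(1)] Comp_assoc[OF f \<iota> e(1)] s(2) e(2) uf by simp
    qed
    then have "e \<cdot> d = Zero C c y"
      using d_right[OF e(1)] Plus_neg[OF e(1)] by simp
    then obtain v where "v \<in> Hom C Q y" "e = v \<cdot> g'"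
      using exact_contravariant[OF tri e(1)] by blast
    then show ?thesis
      using e(2) Comp_assoc[OF \<iota> g'] by (auto simp: g_def)
  qed
  \<comment> \<open>From \<open>d \<cdot> a = 0\<close> follows \<open>s \<cdot> a = a\<close>. As
    \<open>s\<close> raises the index by one, \<open>q (Suc k) \<cdot> s = s \<cdot> q k\<close>, so
    all \<open>q k \<cdot> a\<close> vanish by induction, while some \<open>q k\<close> fixes
    \<open>a\<close>.\<close>
  have inj: "a = Zero C w c" if w: "w \<in> compact_objects C U" and a: "a \<in> Hom C w c" "d \<cdot> a = Zero C w c" for w a
  proof -
    have wo: "w \<in> Obj C" using a Hom_objD by blast
    have sa: "s \<cdot> a = a"
      using d_left[OF a(1)] a(2) Plus_neg_eq_Zero_iff[OF a(1) Comp_Hom[OF a(1) s(1)]] by simp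
    have qs: "q (Suc k) \<cdot> s = s \<cdot> q k" for k
    proof (rule ext[OF Comp_Hom[OF s(1) q] Comp_Hom[OF q s(1)]])
      fix n
      have "(q (Suc k) \<cdot> s) \<cdot> \<iota> n = (q (Suc k) \<cdot> \<iota> (Suc n)) \<cdot> f n"
        using Comp_assoc[OF \<iota> s(1) q] Comp_assoc[OF f \<iota> q] s(2) by simp
      also have "\<dots> = s \<cdot> (q k \<cdot> \<iota> n)"
        using q\<iota> s(2) Comp_Zero_left[OF f co] Comp_Zero_right[OF s(1) X] by simp
      finally show "(q (Suc k) \<cdot> s) \<cdot> \<iota> n = (s \<cdot> q k) \<cdot> \<iota> n"
        using Comp_assoc[OF \<iota> q s(1)] by simp
    qed
    have "q k \<cdot> a = Zero C w c" for k
    proof (induction k)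
      case 0
      have "q 0 = Zero C c c"
        by (rule ext[OF q Zero_Hom[OF co co]]) (simp add: q\<iota> Comp_Zero_left[OF \<iota> co])
      then show ?case using Comp_Zero_left[OF a(1) co] by simp
    next
      case (Suc k)
      have "q (Suc k) \<cdot> a = (q (Suc k) \<cdot> s) \<cdot> a"
        using Comp_assoc[OF a(1) s(1) q] sa by simp
      also have "\<dots> = s \<cdot> (q k \<cdot> a)"
        using qs Comp_assoc[OF a(1) q s(1)] by simp
      finally show ?case
        using Suc Comp_Zero_right[OF s(1) wo] by simp
    qed
    then show ?thesis
      using support'[OF w a(1)] by metis
  qed
  \<comment> \<open>By \<open>inj\<close>, \<open>a\<close> lifts to some \<open>b\<close> into the
    coproduct, and \<open>b\<close> is fixed by some \<open>q k\<close>; on the first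
    \<open>k\<close> summands \<open>g'\<close> agrees with \<open>g k \<cdot> r k\<close>.\<close>
  have surj: "\<exists>n. \<exists>b \<in> Hom C (ShiftO C w) (X n). a = g n \<cdot> b"
    if w: "w \<in> compact_objects C U" "ShiftO C w \<in> compact_objects C U" and a: "a \<in> Hom C (ShiftO C w) Q"
    for w a
  proof -
    have wo: "w \<in> Obj C" using w by (simp add: compact_objects_def)
    obtain b where b: "b \<in> Hom C (ShiftO C w) c" "a = g' \<cdot> b"
      using inj_imp_connecting_zero[OF tri inj[OF w(1)] a wo] by blast
    obtain k where k: "q k \<cdot> b = b" using support'[OF w(2) b(1)] by blast
    have "(g k \<cdot> r k) \<cdot> q k = g' \<cdot> q k"
    proof (rule ext[OF Comp_Hom[OF q Comp_Hom[OF r(1) g]] Comp_Hom[OF q g']])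
      fix n
      show "((g k \<cdot> r k) \<cdot> q k) \<cdot> \<iota> n = (g' \<cdot> q k) \<cdot> \<iota> n"
      proof (cases "n < k")
        case True
        then show ?thesis
          using Comp_assoc[OF \<iota> q Comp_Hom[OF r(1) g]] Comp_assoc[OF \<iota> q g'] q\<iota>
            Comp_assoc[OF \<iota> r(1) g] r(2) gT by (simp add: g_def)
      next
        case False
        then show ?thesis
          using Comp_assoc[OF \<iota> q Comp_Hom[OF r(1) g]] Comp_assoc[OF \<iota> q g'] q\<iota>
            Comp_Zero_right[OF Comp_Hom[OF r(1) g] X] Comp_Zero_right[OF g' X] by simp
      qed
    qed
    then have "a = g k \<cdot> (r k \<cdot> b)"
      using b k Comp_assoc[OF b(1) q Comp_Hom[OF r(1) g]] Comp_assoc[OF b(1) q g']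
        Comp_assoc[OF b(1) r(1) g] by metis
    then show ?thesis
      using Comp_Hom[OF b(1) r(1)] by blast
  qed
  \<comment> \<open>By exactness \<open>\<iota> 0 \<cdot> b 0\<close> is \<open>d \<cdot> b'\<close>
    with \<open>b'\<close> fixed by some \<open>q k\<close>. Moving from summand \<open>n\<close> to
    \<open>Suc n\<close> with \<open>n < k\<close> does not change \<open>r k\<close>, so
    \<open>r k \<cdot> d\<close> kills the first \<open>k\<close> summands; and \<open>r k\<close>
    sends \<open>\<iota> 0 \<cdot> b 0\<close> to \<open>b k\<close>.\<close>
  have mono: "\<exists>k. b k = Zero C w (X k)"
    if w: "w \<in> compact_objects C U" and b: "\<And>n. b n \<in> Hom C w (X n)"
      and bf: "\<And>n. b (Suc n) = f n \<cdot> b n" and b0: "g 0 \<cdot> b 0 = Zero C w Q" for w b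
  proof -
    have "g' \<cdot> (\<iota> 0 \<cdot> b 0) = Zero C w Q"
      using b0 Comp_assoc[OF b \<iota> g'] by (simp add: g_def)
    then obtain b' where b': "b' \<in> Hom C w c" "\<iota> 0 \<cdot> b 0 = d \<cdot> b'"
      using exact_middle[OF tri Comp_Hom[OF b \<iota>]] by blast
    obtain k where k: "q k \<cdot> b' = b'" using support'[OF w b'(1)] by blast
    have rd: "r k \<cdot> d \<in> Hom C c (X k)" using Comp_Hom[OF d r(1)] .
    have "(r k \<cdot> d) \<cdot> q k = Zero C c (X k)"
    proof (rule ext[OF Comp_Hom[OF q rd] Zero_Hom[OF co X]])
      fix n
      have "(r k \<cdot> d) \<cdot> (q k \<cdot> \<iota> n) = Zero C (X n) (X k)"
      proof (cases "n < k")
        case True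
        have "(r k \<cdot> s) \<cdot> \<iota> n = (r k \<cdot> \<iota> (Suc n)) \<cdot> f n"
          using Comp_assoc[OF \<iota> s(1) r(1)] Comp_assoc[OF f \<iota> r(1)] s(2) by simp
        also have "\<dots> = r k \<cdot> \<iota> n"
          using True r(2) T_left by simp
        finally have "(r k \<cdot> d) \<cdot> \<iota> n = Zero C (X n) (X k)"
          using d_right[OF r(1)] diff_Comp[OF \<iota> r(1) Comp_Hom[OF s(1) r(1)]]
            Plus_neg[OF Comp_Hom[OF \<iota> r(1)]] by simp
        then show ?thesis using True q\<iota> by simp
      next
        case False
        then show ?thesis using q\<iota> Comp_Zero_right[OF rd X] by simp
      qed
      then show "((r k \<cdot> d) \<cdot> q k) \<cdot> \<iota> n = Zero C c (X k) \<cdot> \<iota> n"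
        using Comp_assoc[OF \<iota> q rd] Comp_Zero_left[OF \<iota> X] by simp
    qed
    then have "(r k \<cdot> d) \<cdot> b' = Zero C w (X k)"
      using Comp_assoc[OF b'(1) q rd, of k] k Comp_Zero_left[OF b'(1) X] by metis
    then have "T 0 k \<cdot> b 0 = Zero C w (X k)"
      using Comp_assoc[OF b'(1) d r(1)] b'(2) Comp_assoc[OF b \<iota> r(1)] r(2)[of 0 k] by (metis le0)
    moreover have "T 0 n \<cdot> b 0 = b n" for n
    proof (induction n)
      case 0
      then show ?case using T_self Comp_Ident_left[OF b] by simp
    next
      case (Suc n)
      then show ?case using T_Suc[of 0 n] bf Comp_assoc[OF b T f, of 0 n] by simp
    qed
    ultimately show ?thesis by auto
  qed
  show ?thesis
    by (rule that) (fact g compat universal surj mono)+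
qed

end

section \<open>Approximation and truncation\<close>

text \<open>A real number above the supremum lies strictly above each \<open>pdim\<close>, hence
  above some admissible \<open>n\<close>, whether or not the infimum is attained. Conversely, a
  common \<open>d\<close> is admissible for every \<open>x\<close>.\<close>

lemma gldim_finite_iff:
  "gldim C H < \<infinity> \<longleftrightarrow> (\<exists>d :: int. \<forall>x\<in>H. \<forall>y\<in>H. \<forall>i>d. hom_vanishes C x (shift C i y))"
proof
  assume "gldim C H < \<infinity>"
  then obtain r where r: "gldim C H < ereal r"
    using less_PInf_Ex_of_nat by (metis less_ereal.simps(2) ereal_dense2)
  have "hom_vanishes C x (shift C i y)" if x: "x \<in> H" and y: "y \<in> H" and i: "i > \<lceil>r\<rceil>" for x y i
  proof -
    have "pdim C H x \<le> gldim C H"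
      unfolding gldim_def using x by (rule SUP_upper)
    then have "pdim C H x < ereal r" using r by simp
    then obtain n where n: "n < ereal r"
      "\<forall>i :: int. n < ereal (of_int i) \<longrightarrow> (\<forall>y\<in>H. hom_vanishes C x (shift C i y))"
      unfolding pdim_def Inf_less_iff by blast
    have "ereal r \<le> ereal (of_int i)" using i by (simp add: ceiling_less_iff)
    then have "n < ereal (of_int i)" using n(1) less_le_trans by blast
    then show ?thesis using n(2) y by blast
  qed
  then show "\<exists>d :: int. \<forall>x\<in>H. \<forall>y\<in>H. \<forall>i>d. hom_vanishes C x (shift C i y)" by blast
next
  assume "\<exists>d :: int. \<forall>x\<in>H. \<forall>y\<in>H. \<forall>i>d. hom_vanishes C x (shift C i y)"
  then obtain d :: int where d: "\<forall>x\<in>H. \<forall>y\<in>H. \<forall>i>d. hom_vanishes C x (shift C i y)" by blast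
  have "pdim C H x \<le> ereal (of_int d)" if "x \<in> H" for x
    unfolding pdim_def by (rule Inf_lower) (use d that in auto)
  then have "gldim C H \<le> ereal (of_int d)"
    unfolding gldim_def by (rule SUP_least)
  then show "gldim C H < \<infinity>" by auto
qed

locale silting_category = compactly_generated_category +
  fixes M
  assumes silting: "compact_silting C U M"
begin

section \<open>Shifts of \<open>M\<close> as test objects\<close>

abbreviation N :: "int \<Rightarrow> 'a" where
  "N i \<equiv> shift C (- i) M"

lemma M_Obj: "M \<in> Obj C"
  using silting by (simp add: compact_silting_def compact_objects_def)

lemma N_Obj: "N i \<in> Obj C"
  using M_Obj shift_Obj by blast

lemma N_compact: "N i \<in> compact_objects C U"
proof -
  have "M \<in> thick_closure C {M}" by (rule hull_inc) simp
  then have "N i \<in> thick_closure C {M}"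
    using thick_shift unfolding hull_def by blast
  then show ?thesis
    using silting by (simp add: compact_silting_def)
qed

lemma compact_induct: "\<lbrakk>thick C S; M \<in> S\<rbrakk> \<Longrightarrow> compact_objects C U \<subseteq> S"
  using hull_minimal[of "{M}" S "thick C"] silting by (simp add: compact_silting_def)

lemma ShiftO_N: "ShiftO C (N i) = N (i - 1)"
  using ShiftO_shift[OF M_Obj] by simp

lemma perp_N_iff: "y \<in> perp C M I \<longleftrightarrow> y \<in> Obj C \<and> (\<forall>i\<in>I. hom_vanishes C (N i) y)"
  using perp_iff[OF M_Obj] .

lemma perp_ObjD: "y \<in> perp C M I \<Longrightarrow> y \<in> Obj C"
  by (simp add: perp_def)

text \<open>The objects left orthogonal to all shifts of \<open>y\<close> form a thick subcategory.
  Containing \<open>M\<close>, it contains every compact object, in particular a generating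
  set.\<close>

lemma perp_UNIV:
  assumes "y \<in> perp C M UNIV"
  shows "zero_object C y"
proof -
  have y: "y \<in> Obj C" "\<forall>i. hom_vanishes C M (shift C i y)"
    using assms by (auto simp: perp_def)
  obtain G where G: "G \<subseteq> compact_objects C U"
    "\<forall>x \<in> Obj C. (\<forall>g\<in>G. \<forall>n. hom_vanishes C g (shift C n x)) \<longrightarrow> zero_object C x"
    using compact_generators by blast
  have "compact_objects C U \<subseteq> {x \<in> Obj C. \<forall>n. hom_vanishes C x (shift C n y)}"
    using compact_induct[OF left_orthogonal_thick[OF y(1)]] M_Obj y(2) by blast
  then show ?thesis
    using G y(1) by blast
qed

text \<open>For fixed \<open>t\<close> the condition defines a thick subcategory of test objects, so
  checking it on \<open>M\<close> checks it on the whole thick closure.\<close>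

lemma bounded_objects_iff: "t \<in> bounded_objects C U \<longleftrightarrow> t \<in> Obj C \<and> hom_bounded C M t"
proof
  assume "t \<in> bounded_objects C U"
  then show "t \<in> Obj C \<and> hom_bounded C M t"
    using silting by (auto simp: bounded_objects_def compact_silting_def)
next
  assume t: "t \<in> Obj C \<and> hom_bounded C M t"
  then have "compact_objects C U \<subseteq> {x \<in> Obj C. hom_bounded C x t}"
    using compact_induct[OF hom_bounded_thick] M_Obj by blast
  then show "t \<in> bounded_objects C U"
    using t by (auto simp: bounded_objects_def)
qed

text \<open>\<open>t'\<close> is the cone of the universal map to \<open>t\<close> from a coproduct
  of copies of \<open>N i\<close>, one for each morphism from \<open>N i\<close> to
  \<open>t\<close>; hence all of these die in \<open>t'\<close>. By compactness, \<open>N j\<close>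
  with \<open>j\<close> in \<open>J\<close> has no nonzero map to this coproduct, which gives
  injectivity at \<open>N j\<close> and surjectivity at its shift \<open>N (j - 1)\<close>. Objects
  without nonzero maps from \<open>N i\<close> have none from the coproduct, so maps into them
  extend.\<close>

lemma approximation_step:
  assumes t: "t \<in> Obj C" and J: "\<And>j. j \<in> J \<Longrightarrow> hom_vanishes C M (shift C (j - i) M)"
  obtains t' f where "f \<in> Hom C t t'"
    "\<forall>j\<in>J. \<forall>a \<in> Hom C (N j) t. f \<cdot> a = Zero C (N j) t' \<longrightarrow> a = Zero C (N j) t"
    "\<forall>j\<in>J. \<forall>b \<in> Hom C (N (j - 1)) t'. \<exists>a \<in> Hom C (N (j - 1)) t. b = f \<cdot> a"
    "\<forall>a \<in> Hom C (N i) t. f \<cdot> a = Zero C (N i) t'"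
    "\<forall>y. hom_vanishes C (N i) y \<longrightarrow> (\<forall>a \<in> Hom C t y. \<exists>b \<in> Hom C t' y. a = b \<cdot> f)"
proof -
  let ?A = "Hom C (N i) t"
  have small: "?A \<prec> U" using locally_small[OF N_Obj t] .
  \<comment> \<open>\<open>e\<close> renames the morphisms as elements of \<open>U\<close>, where
    index sets live.\<close>
  then obtain e where e: "inj_on e ?A" "e ` ?A \<subseteq> U"
    by (auto simp: lesspoll_def lepoll_def)
  let ?I = "e ` ?A"
  have I: "?I \<prec> U" using small e(1) by simp
  obtain c \<iota> where cop: "is_coproduct C ?I (\<lambda>_. N i) c \<iota>"
    using small_coproducts[OF I, of "\<lambda>_. N i"] N_Obj by auto
  have co: "c \<in> Obj C" using coproduct_Obj[OF cop] .
  obtain p where p: "p \<in> Hom C c t" "\<And>u. u \<in> ?I \<Longrightarrow> p \<cdot> \<iota> u = inv_into ?A e u"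
    using coproduct_desc[OF cop t, of "inv_into ?A e"] inv_into_into[of _ e ?A] by blast
  have pa: "p \<cdot> \<iota> (e a) = a" "\<iota> (e a) \<in> Hom C (N i) c" if "a \<in> ?A" for a
    using p(2)[of "e a"] that inv_into_f_f[OF e(1) that] coproduct_Hom[OF cop] by auto
  obtain t' f h where tri: "dist_triangle C c t t' p f h"
    using TR1_cone[OF p(1)] by blast
  note D = dist_triangleD[OF tri]
  have v: "hom_vanishes C (N j) c" if "j \<in> J" for j
  proof (rule hom_vanishes_coproduct[OF N_compact I cop])
    show "hom_vanishes C (N j) (N i)"
      using J[OF that] hom_vanishes_shift_right[OF M_Obj M_Obj, of "- j" "- i"] by simp
  qed
  show ?thesis
  proof (rule that[of f t'])
    show "f \<in> Hom C t t'" using D by simp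
    show "\<forall>j\<in>J. \<forall>a \<in> Hom C (N j) t. f \<cdot> a = Zero C (N j) t' \<longrightarrow> a = Zero C (N j) t"
    proof (intro ballI impI)
      fix j a assume j: "j \<in> J" and a: "a \<in> Hom C (N j) t" "f \<cdot> a = Zero C (N j) t'"
      obtain b where "b \<in> Hom C (N j) c" "a = p \<cdot> b"
        using exact_middle[OF tri a] .
      then show "a = Zero C (N j) t"
        using hom_vanishesD[OF v[OF j]] Comp_Zero_right[OF p(1) N_Obj] by metis
    qed
    show "\<forall>j\<in>J. \<forall>b \<in> Hom C (N (j - 1)) t'. \<exists>a \<in> Hom C (N (j - 1)) t. b = f \<cdot> a"
    proof (intro ballI)
      fix j b assume j: "j \<in> J" and b: "b \<in> Hom C (N (j - 1)) t'"
      have "hom_vanishes C (N (j - 1)) (ShiftO C c)"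
        using v[OF j] hom_vanishes_ShiftO[OF N_Obj co, of j] ShiftO_N by simp
      then show "\<exists>a \<in> Hom C (N (j - 1)) t. b = f \<cdot> a"
        using surj_on_hom[OF tri _ b] by blast
    qed
    show "\<forall>a \<in> Hom C (N i) t. f \<cdot> a = Zero C (N i) t'"
    proof
      fix a assume a: "a \<in> Hom C (N i) t"
      have "f \<cdot> (p \<cdot> \<iota> (e a)) = Zero C (N i) t'"
        using Comp_assoc[OF pa(2)[OF a] D(1,2)] dist_comp_zero[OF tri] Comp_Zero_left[OF pa(2)[OF a] D(6)]
        by simp
      then show "f \<cdot> a = Zero C (N i) t'"
        using pa(1)[OF a] by simp
    qed
    show "\<forall>y. hom_vanishes C (N i) y \<longrightarrow> (\<forall>a \<in> Hom C t y. \<exists>b \<in> Hom C t' y. a = b \<cdot> f)"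
    proof (intro allI impI ballI)
      fix y a assume y: "hom_vanishes C (N i) y" and a: "a \<in> Hom C t y"
      have yo: "y \<in> Obj C" using Hom_objD[OF a] by simp
      have "a \<cdot> p = Zero C c y"
      proof (rule coproduct_ext[OF cop Comp_Hom[OF p(1) a] Zero_Hom[OF co yo]])
        fix u assume u: "u \<in> ?I"
        show "(a \<cdot> p) \<cdot> \<iota> u = Zero C c y \<cdot> \<iota> u"
          using hom_vanishesD[OF y Comp_Hom[OF coproduct_Hom[OF cop u] Comp_Hom[OF p(1) a]]]
            Comp_Zero_left[OF coproduct_Hom[OF cop u] yo] by simp
      qed
      then show "\<exists>b \<in> Hom C t' y. a = b \<cdot> f"
        using exact_contravariant[OF tri a] by blast
    qed
  qed
qed

text \<open>
  Both truncation with respect to the t-structure and the weight-like truncation used for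
  bounded projective objects are instances. The indices in \<open>I\<close> are treated one at a time,
  each infinitely often, so that only coproducts of copies of one \<open>N i\<close> and countable
  coproducts are needed.
\<close>

lemma approximation:
  assumes t: "t \<in> Obj C" and IJ: "\<And>i j. \<lbrakk>i \<in> I; j \<in> J\<rbrakk> \<Longrightarrow> hom_vanishes C M (shift C (j - i) M)"
  obtains Q Z f g h where "dist_triangle C t Q Z f g h" "Q \<in> perp C M I"
    "\<forall>j\<in>J. hom_vanishes C (N (j - 1)) Z"
    "\<forall>y \<in> perp C M I. \<forall>a \<in> Hom C t y. \<exists>b \<in> Hom C Q y. a = b \<cdot> f"
proof -
  \<comment> \<open>Every integer occurs infinitely often as \<open>idx n\<close>, since the second
    component of the decoded pair is free.\<close>
  define idx :: "nat \<Rightarrow> int" where "idx n = int_decode (fst (prod_decode n))" for n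
  define good where "good i x x' f \<longleftrightarrow> f \<in> Hom C x x' \<and>
    (\<forall>j\<in>J. \<forall>a \<in> Hom C (N j) x. f \<cdot> a = Zero C (N j) x' \<longrightarrow> a = Zero C (N j) x) \<and>
    (\<forall>j\<in>J. \<forall>b \<in> Hom C (N (j - 1)) x'. \<exists>a \<in> Hom C (N (j - 1)) x. b = f \<cdot> a) \<and>
    (i \<in> I \<longrightarrow> (\<forall>a \<in> Hom C (N i) x. f \<cdot> a = Zero C (N i) x')) \<and>
    (\<forall>y \<in> perp C M I. \<forall>a \<in> Hom C x y. \<exists>b \<in> Hom C x' y. a = b \<cdot> f)" for i x x' f
  have ex: "\<exists>x' f. good i x x' f" if x: "x \<in> Obj C" for i x
  proof (cases "i \<in> I")
    case True
    obtain x' f where *: "f \<in> Hom C x x'"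
      "\<forall>j\<in>J. \<forall>a \<in> Hom C (N j) x. f \<cdot> a = Zero C (N j) x' \<longrightarrow> a = Zero C (N j) x"
      "\<forall>j\<in>J. \<forall>b \<in> Hom C (N (j - 1)) x'. \<exists>a \<in> Hom C (N (j - 1)) x. b = f \<cdot> a"
      "\<forall>a \<in> Hom C (N i) x. f \<cdot> a = Zero C (N i) x'"
      "\<forall>y. hom_vanishes C (N i) y \<longrightarrow> (\<forall>a \<in> Hom C x y. \<exists>b \<in> Hom C x' y. a = b \<cdot> f)"
      using approximation_step[of x J i, OF x IJ[OF True]] .
    have "\<forall>y \<in> perp C M I. \<forall>a \<in> Hom C x y. \<exists>b \<in> Hom C x' y. a = b \<cdot> f"
      using *(5) perp_N_iff True by blast
    then have "good i x x' f"
      unfolding good_def using *(1-4) by blast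
    then show ?thesis by blast
  next
    case False
    have "good i x x (Ident C x)"
      unfolding good_def
    proof (intro conjI ballI impI)
      show "\<exists>a \<in> Hom C (N (j - 1)) x. b = Ident C x \<cdot> a" if "b \<in> Hom C (N (j - 1)) x" for b j
        using that Comp_Ident_left[OF that] by (intro bexI[of _ b]) simp
      show "\<exists>b \<in> Hom C x y. a = b \<cdot> Ident C x" if "a \<in> Hom C x y" for a y
        using that Comp_Ident_right[OF that] by (intro bexI[of _ a]) simp
    qed (use False Ident_Hom[OF x] in \<open>simp_all add: Comp_Ident_left\<close>)
    then show ?thesis by blast
  qed
  have "\<forall>n x. \<exists>x' f. x \<in> Obj C \<longrightarrow> good (idx n) x x' f"
    using ex by blast
  then obtain nx nf where step: "\<And>n x. x \<in> Obj C \<Longrightarrow> good (idx n) x (nx n x) (nf n x)"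
    by metis
  define X where "X = rec_nat t nx"
  define f where "f n = nf n (X n)" for n
  have X0: "X 0 = t" and XS: "X (Suc n) = nx n (X n)" for n by (simp_all add: X_def)
  have X: "X n \<in> Obj C" for n
  proof (induction n)
    case 0
    then show ?case using X0 t by simp
  next
    case (Suc n)
    then have "nf n (X n) \<in> Hom C (X n) (nx n (X n))"
      using step[of "X n" n] by (simp add: good_def)
    then show ?case using XS Hom_objD by simp
  qed
  have good: "good (idx n) (X n) (X (Suc n)) (f n)" for n
    using step[OF X] XS by (simp add: f_def)
  have f: "f n \<in> Hom C (X n) (X (Suc n))" for n
    using good[of n] by (simp add: good_def)
  show ?thesis
  proof (rule homotopy_colimit[of X f, OF X f])
    fix Q g
    assume g: "\<And>n. g n \<in> Hom C (X n) Q" and gf: "\<And>n. g (Suc n) \<cdot> f n = g n"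
      and universal: "\<And>y u. \<lbrakk>\<And>n. u n \<in> Hom C (X n) y; \<And>n. u (Suc n) \<cdot> f n = u n\<rbrakk>
        \<Longrightarrow> \<exists>v \<in> Hom C Q y. \<forall>n. v \<cdot> g n = u n"
      and surj: "\<And>w a. \<lbrakk>w \<in> compact_objects C U; ShiftO C w \<in> compact_objects C U; a \<in> Hom C (ShiftO C w) Q\<rbrakk>
        \<Longrightarrow> \<exists>n. \<exists>b \<in> Hom C (ShiftO C w) (X n). a = g n \<cdot> b"
      and mono: "\<And>w b. \<lbrakk>w \<in> compact_objects C U; \<And>n. b n \<in> Hom C w (X n);
        \<And>n. b (Suc n) = f n \<cdot> b n; g 0 \<cdot> b 0 = Zero C w Q\<rbrakk> \<Longrightarrow> \<exists>k. b k = Zero C w (X k)"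
    have g0: "g 0 \<in> Hom C t Q" using g[of 0] X0 by simp
    have Qo: "Q \<in> Obj C" using g Hom_objD by blast
    obtain Z g' h where tri: "dist_triangle C t Q Z (g 0) g' h"
      using TR1_cone[OF g0] by blast
    have surjN: "\<exists>n. \<exists>b \<in> Hom C (N i) (X n). a = g n \<cdot> b" if "a \<in> Hom C (N i) Q" for i a
      using surj[OF N_compact, of "i + 1" a] N_compact that ShiftO_N[of "i + 1"] by simp
    have "a = Zero C (N i) Q" if i: "i \<in> I" and a: "a \<in> Hom C (N i) Q" for i a
    proof -
      obtain n b where b: "b \<in> Hom C (N i) (X n)" "a = g n \<cdot> b"
        using surjN[OF a] by blast
      \<comment> \<open>A stage not before \<open>n\<close> at which degree \<open>i\<close> is
        treated: \<open>b\<close> is pushed forward to it and killed by the next map.\<close>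
      let ?m = "prod_encode (int_encode i, n)"
      have "\<exists>b \<in> Hom C (N i) (X m). a = g m \<cdot> b" if "n \<le> m" for m
        using that
      proof (induction m rule: dec_induct)
        case base
        then show ?case using b by blast
      next
        case (step m)
        then obtain b' where b': "b' \<in> Hom C (N i) (X m)" "a = g m \<cdot> b'" by blast
        then have "a = g (Suc m) \<cdot> (f m \<cdot> b')"
          using Comp_assoc[OF b'(1) f g] gf by simp
        then show ?case using Comp_Hom[OF b'(1) f] by blast
      qed
      then obtain b' where b': "b' \<in> Hom C (N i) (X ?m)" "a = g ?m \<cdot> b'"
        using le_prod_encode_2 by blast
      have "f ?m \<cdot> b' = Zero C (N i) (X (Suc ?m))"
        using good[of ?m] i b'(1) by (simp add: good_def idx_def)
      moreover have "a = g (Suc ?m) \<cdot> (f ?m \<cdot> b')"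
        using Comp_assoc[OF b'(1) f g] gf b'(2) by simp
      ultimately show ?thesis
        using Comp_Zero_right[OF g N_Obj] by simp
    qed
    then have Q: "Q \<in> perp C M I"
      using perp_N_iff hom_vanishes_iff[OF N_Obj Qo] Qo by blast
    have Z: "hom_vanishes C (N (j - 1)) Z" if j: "j \<in> J" for j
    proof -
      have "a = Zero C (N j) t" if a: "a \<in> Hom C (N j) t" "g 0 \<cdot> a = Zero C (N j) Q" for a
      proof -
        \<comment> \<open>\<open>b\<close> follows \<open>a\<close> through the sequence. If
          \<open>a\<close> dies in the homotopy colimit it dies at a finite stage, and injectivity
          of each step carries this back to \<open>a\<close>.\<close>
        define b where "b = rec_nat a (\<lambda>n b. f n \<cdot> b)"
        have b0: "b 0 = a" and bS: "\<And>n. b (Suc n) = f n \<cdot> b n"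
          by (simp_all add: b_def)
        have b: "b n \<in> Hom C (N j) (X n)" for n
        proof (induction n)
          case 0
          then show ?case using b0 X0 a(1) by simp
        next
          case (Suc n)
          then show ?case using bS Comp_Hom[OF Suc f] by simp
        qed
        obtain k where k: "b k = Zero C (N j) (X k)"
          using mono[OF N_compact b bS] b0 a(2) by auto
        have "b n = Zero C (N j) (X n)" if "b (Suc n) = Zero C (N j) (X (Suc n))" for n
          using good[of n] j b[of n] bS that unfolding good_def by metis
        then have "b k = Zero C (N j) (X k) \<Longrightarrow> b 0 = Zero C (N j) (X 0)"
          by (induction k) auto
        then show ?thesis using k b0 X0 by simp
      qed
      moreover have "\<exists>a \<in> Hom C (N (j - 1)) t. b = g 0 \<cdot> a" if b: "b \<in> Hom C (N (j - 1)) Q" for b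
      proof -
        \<comment> \<open>Surjectivity of each step pulls a morphism at stage \<open>n\<close> back
          to stage 0 without changing its image in \<open>Q\<close>.\<close>
        have "\<exists>a \<in> Hom C (N (j - 1)) t. g n \<cdot> b' = g 0 \<cdot> a" if "b' \<in> Hom C (N (j - 1)) (X n)" for n b'
          using that
        proof (induction n arbitrary: b')
          case 0
          then show ?case using X0 by auto
        next
          case (Suc n)
          then obtain b'' where b'': "b'' \<in> Hom C (N (j - 1)) (X n)" "b' = f n \<cdot> b''"
            using good[of n] j unfolding good_def by blast
          then have "g (Suc n) \<cdot> b' = g n \<cdot> b''"
            using Comp_assoc[OF b''(1) f g] gf by simp
          then show ?case using Suc.IH[OF b''(1)] by simp
        qed
        then show ?thesis using surjN[OF b] by blast
      qed
      ultimately show ?thesis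
        using vanishes_cone[OF tri, of "N j"] N_Obj ShiftO_N by metis
    qed
    have ext: "\<exists>b \<in> Hom C Q y. a = b \<cdot> g 0" if y: "y \<in> perp C M I" and a: "a \<in> Hom C t y" for y a
    proof -
      \<comment> \<open>The extensions are chosen compatibly, stage by stage; the clause for
        \<open>n = 0\<close> pins the first one to \<open>a\<close>.\<close>
      have "\<exists>u. \<forall>n. (u n \<in> Hom C (X n) y \<and> (n = 0 \<longrightarrow> u n = a)) \<and> u n = u (Suc n) \<cdot> f n"
      proof (rule dependent_nat_choice)
        show "\<exists>x. x \<in> Hom C (X 0) y \<and> ((0 :: nat) = 0 \<longrightarrow> x = a)"
          using a X0 by auto
        show "\<exists>x'. (x' \<in> Hom C (X (Suc n)) y \<and> (Suc n = 0 \<longrightarrow> x' = a)) \<and> x = x' \<cdot> f n"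
          if "x \<in> Hom C (X n) y \<and> (n = 0 \<longrightarrow> x = a)" for x n
          using good[of n] y that unfolding good_def by blast
      qed
      then obtain u where u: "\<And>n. u n \<in> Hom C (X n) y" "u 0 = a" "\<And>n. u (Suc n) \<cdot> f n = u n"
        by metis
      then show ?thesis
        using universal[of u y] by metis
    qed
    show ?thesis
      using that[OF tri Q] Z ext by blast
  qed
qed

section \<open>Heart, truncation and devissage for the silting t-structure\<close>

abbreviation H :: "'a set" where
  "H \<equiv> heart C (silting_t_structure C M)"

lemma perp_shift_iff:
  assumes "y \<in> Obj C"
  shows "shift C n y \<in> perp C M I \<longleftrightarrow> (\<forall>i\<in>I. hom_vanishes C M (shift C (i + n) y))"
  using shift_Obj[OF assms] shift_shift[OF assms] by (simp add: perp_def)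

text \<open>The aisle clears the positive degrees. Writing \<open>y\<close> as the shift of an
  object of the coaisle turns vanishing in degrees at most 0 into vanishing of \<open>y\<close> in
  degrees at most -1, so only degree 0 survives.\<close>

lemma heart_iff: "y \<in> H \<longleftrightarrow> y \<in> perp C M (- {0})"
proof
  assume y: "y \<in> perp C M (- {0})"
  have yo: "y \<in> Obj C" using perp_ObjD[OF y] .
  have v: "hom_vanishes C M (shift C i y)" if "i \<noteq> 0" for i
    using y that by (auto simp: perp_def)
  have "y = shift C 1 (shift C (- 1) y)"
    using shift_shift[OF yo] by simp
  moreover have "shift C (- 1) y \<in> perp C M {..0}"
    unfolding perp_shift_iff[OF yo] using v by auto
  moreover have "y \<in> perp C M {0<..}"
    using v yo by (auto simp: perp_def)
  ultimately show "y \<in> H"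
    unfolding heart_def silting_t_structure_def by auto
next
  assume "y \<in> H"
  then obtain x where y: "y \<in> perp C M {0<..}" and x: "x \<in> perp C M {..0}" "y = shift C 1 x"
    unfolding heart_def silting_t_structure_def by auto
  have xo: "x \<in> Obj C" using perp_ObjD[OF x(1)] .
  have "hom_vanishes C M (shift C i y)" if "i \<noteq> 0" for i
  proof (cases "0 < i")
    case True
    then show ?thesis using y by (auto simp: perp_def)
  next
    case False
    then have "i + 1 \<in> {..0}" using that by simp
    then show ?thesis using x shift_shift[OF xo] unfolding perp_def by auto
  qed
  then show "y \<in> perp C M (- {0})"
    using perp_ObjD[OF y] by (auto simp: perp_def)
qed

lemma heart_Obj: "h \<in> H \<Longrightarrow> h \<in> Obj C"
  using heart_iff perp_ObjD by blast

lemma heart_bounded: "h \<in> H \<Longrightarrow> h \<in> bounded_objects C U"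
  unfolding heart_iff bounded_objects_iff hom_bounded_def perp_def
  by (auto intro!: exI[of _ 0])

lemma hom_vanishes_N_ShiftO:
  assumes "x \<in> Obj C"
  shows "hom_vanishes C (N (i - 1)) (ShiftO C x) \<longleftrightarrow> hom_vanishes C (N i) x"
  using hom_vanishes_ShiftO[OF N_Obj assms, of i] ShiftO_N by simp

lemma hom_vanishes_N_unshift:
  assumes "x \<in> Obj C"
  shows "hom_vanishes C (N i) (unshift x) \<longleftrightarrow> hom_vanishes C (N (i - 1)) x"
  using hom_vanishes_N_ShiftO[OF unshift_Obj[OF assms], of i] ShiftO_unshift[OF assms] by simp

text \<open>For \<open>i \<le> n < j\<close> the silting condition applies to the positive degree
  \<open>j - i\<close>. With \<open>J\<close> all degrees above \<open>n\<close>, \<open>Z\<close>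
  is cleared from \<open>n\<close> itself on, as \<open>approximation\<close> lowers the index by
  one.\<close>

lemma truncation:
  assumes "t \<in> Obj C"
  obtains Q Z f g h where "dist_triangle C t Q Z f g h" "Q \<in> perp C M {..n}"
    "\<forall>j\<ge>n. hom_vanishes C (N j) Z"
    "\<forall>y \<in> perp C M {..n}. \<forall>a \<in> Hom C t y. \<exists>b \<in> Hom C Q y. a = b \<cdot> f"
proof (rule approximation[OF assms, of "{..n}" "{n<..}"])
  show "hom_vanishes C M (shift C (j - i) M)" if "i \<in> {..n}" "j \<in> {n<..}" for i j
    using silting that by (auto simp: compact_silting_def)
next
  fix Q Z f g h
  assume *: "dist_triangle C t Q Z f g h" "Q \<in> perp C M {..n}"
    and Z: "\<forall>j \<in> {n<..}. hom_vanishes C (N (j - 1)) Z"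
    and ext: "\<forall>y \<in> perp C M {..n}. \<forall>a \<in> Hom C t y. \<exists>b \<in> Hom C Q y. a = b \<cdot> f"
  have "hom_vanishes C (N j) Z" if "j \<ge> n" for j
    using bspec[OF Z, of "j + 1"] that by simp
  then show thesis
    using that[OF *] ext by blast
qed

text \<open>The truncation \<open>Q\<close> of \<open>x\<close> has no cohomology up to
  \<open>n\<close> by construction, and none above \<open>n\<close> because neither \<open>x\<close>
  nor \<open>Z\<close> has any. So \<open>Q\<close> is zero, yet every morphism from
  \<open>x\<close> to \<open>y\<close> factors through it.\<close>

lemma orthogonal:
  assumes x: "x \<in> perp C M {n<..}" and y: "y \<in> perp C M {..n}"
  shows "hom_vanishes C x y"
proof -
  have xo: "x \<in> Obj C" and yo: "y \<in> Obj C" using x y perp_ObjD by auto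
  obtain Q Z f g h where tri: "dist_triangle C x Q Z f g h" and Q: "Q \<in> perp C M {..n}"
    and Z: "\<forall>j\<ge>n. hom_vanishes C (N j) Z"
    and ext: "\<forall>y \<in> perp C M {..n}. \<forall>a \<in> Hom C x y. \<exists>b \<in> Hom C Q y. a = b \<cdot> f"
    using truncation[OF xo, of n] .
  have "hom_vanishes C (N i) Q" for i
  proof (cases "i \<le> n")
    case True
    then show ?thesis using Q perp_N_iff by auto
  next
    case False
    then have "hom_vanishes C (N i) x" using x perp_N_iff by auto
    then show ?thesis using vanishes_middle[OF tri _ _ N_Obj] Z False by simp
  qed
  then have "zero_object C Q"
    using perp_UNIV perp_N_iff dist_triangleD(5)[OF tri] by blast
  then have v: "hom_vanishes C Q y"
    using hom_vanishes_zero_object yo by blast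
  have "a = Zero C x y" if a: "a \<in> Hom C x y" for a
  proof -
    obtain b where "b \<in> Hom C Q y" "a = b \<cdot> f" using ext y a by blast
    then show ?thesis
      using hom_vanishesD[OF v] Comp_Zero_left[OF dist_triangleD(1)[OF tri] yo] by metis
  qed
  then show ?thesis using hom_vanishes_iff xo yo by blast
qed

text \<open>Truncation just below the top degree \<open>c\<close> gives a triangle Z[-1] -> t -> Q
  in which \<open>Q\<close> is a shifted heart object and Z[-1] lives in degrees below
  \<open>c\<close>.\<close>

lemma devissage:
  assumes zero: "\<And>z. zero_object C z \<Longrightarrow> P z"
    and ext: "\<And>x y z f g h. \<lbrakk>dist_triangle C x y z f g h; P x; P z\<rbrakk> \<Longrightarrow> P y"
    and heart: "\<And>h n. \<lbrakk>h \<in> H; a \<le> n; n \<le> b\<rbrakk> \<Longrightarrow> P (shift C (- n) h)"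
    and t: "t \<in> perp C M (- {a..b})"
  shows "P t"
proof -
  \<comment> \<open>\<open>k\<close> counts the degrees, from \<open>a\<close> upwards, in which
    \<open>t\<close> may have cohomology.\<close>
  have step: "P t" if "t \<in> perp C M (- {a..a + int k - 1})" "a + int k - 1 \<le> b" for k t
    using that
  proof (induction k arbitrary: t)
    case 0
    then have "t \<in> perp C M UNIV" by simp
    then show ?case using perp_UNIV zero by blast
  next
    case (Suc k)
    define c where "c = a + int k"
    have to: "t \<in> Obj C" using perp_ObjD Suc.prems(1) by blast
    have t: "hom_vanishes C (N i) t" if "i < a \<or> i > c" for i
      using Suc.prems(1) that perp_N_iff by (auto simp: c_def)
    obtain Q Z f g h where tri: "dist_triangle C t Q Z f g h" and Q: "Q \<in> perp C M {..c - 1}"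
      and Z: "\<forall>j\<ge>c - 1. hom_vanishes C (N j) Z"
      using truncation[OF to, of "c - 1"] by metis
    have o: "Q \<in> Obj C" "Z \<in> Obj C" using dist_triangleD[OF tri] by auto
    have Q': "hom_vanishes C (N i) Q" if "i \<noteq> c" for i
    proof (cases "i < c")
      case True
      then show ?thesis using Q perp_N_iff by auto
    next
      case False
      then show ?thesis using vanishes_middle[OF tri t _ N_Obj] Z that by simp
    qed
    have "hom_vanishes C M (shift C (i + c) Q)" if "i \<noteq> 0" for i
      using Q'[of "i + c"] that hom_vanishes_shift_left[OF M_Obj o(1)] by simp
    then have "shift C c Q \<in> H"
      using heart_iff perp_shift_iff[OF o(1)] by auto
    then have "P (shift C (- c) (shift C c Q))"
      by (rule heart) (use Suc.prems(2) in \<open>simp_all add: c_def\<close>)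
    then have PQ: "P Q"
      using shift_shift[OF o(1)] by simp
    \<comment> \<open>Above \<open>c - 1\<close> this is the truncation bound moved by one; below
      \<open>a\<close> it comes from the rotated triangle, where \<open>Z\<close> lies between
      \<open>Q\<close> and \<open>t[1]\<close>.\<close>
    have "hom_vanishes C (N i) (unshift Z)" if "i < a \<or> i > c - 1" for i
    proof (cases "i > c - 1")
      case True
      then show ?thesis using hom_vanishes_N_unshift[OF o(2), of i] spec[OF Z, of "i - 1"] by simp
    next
      case False
      then have "i < a" using that by simp
      then have "hom_vanishes C (N (i - 1)) (ShiftO C t)" "hom_vanishes C (N (i - 1)) Q"
        using hom_vanishes_N_ShiftO[OF to, of i] t[of i] Q'[of "i - 1"] False by auto
      then have "hom_vanishes C (N (i - 1)) Z"
        using vanishes_middle[OF rotate[OF tri] _ _ N_Obj] by blast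
      then show ?thesis using hom_vanishes_N_unshift[OF o(2)] by simp
    qed
    then have "unshift Z \<in> perp C M (- {a..a + int k - 1})"
      using perp_N_iff unshift_Obj[OF o(2)] by (auto simp: c_def)
    then have "P (unshift Z)"
      using Suc.IH Suc.prems(2) by simp
    then show ?case
      using rotate_back[OF tri] ext PQ by metis
  qed
  show ?thesis
  proof (cases "a \<le> b")
    case True
    then show ?thesis using step[of t "nat (b - a + 1)"] t by simp
  next
    case False
    then have "t \<in> perp C M UNIV" using t by simp
    then show ?thesis using perp_UNIV zero by blast
  qed
qed

section \<open>Bounded objects and bounds uniform on the heart\<close>

lemma bounded_amplitude:
  assumes "t \<in> bounded_objects C U"
  obtains K where "0 \<le> K" "t \<in> perp C M (- {- K..K})"
proof -
  obtain K where "\<And>n. \<bar>n\<bar> > K \<Longrightarrow> hom_vanishes C M (shift C n t)" and "t \<in> Obj C"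
    using assms bounded_objects_iff by (auto simp: hom_bounded_def)
  then have "t \<in> perp C M (- {- max 0 K..max 0 K})"
    by (auto simp: perp_def)
  then show ?thesis using that[of "max 0 K"] by simp
qed

text \<open>Devissage is applied first to \<open>t\<close> and then to \<open>s\<close>; the
  amplitudes \<open>K\<close> and \<open>L\<close> add to the bound that holds between heart
  objects.\<close>

lemma hom_bounded_of_heart:
  assumes d: "\<And>x y i. \<lbrakk>x \<in> H; y \<in> H; i > d\<rbrakk> \<Longrightarrow> hom_vanishes C x (shift C i y)"
    and t: "t \<in> bounded_objects C U" and s: "s \<in> bounded_objects C U"
  shows "hom_bounded C t s"
proof -
  define e where "e = max 0 d"
  \<comment> \<open>Negative degrees vanish by orthogonality in the t-structure, so the one-sided
    bound \<open>d\<close> becomes a two-sided bound.\<close>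
  have e: "hom_vanishes C x (shift C i y)" if "x \<in> H" "y \<in> H" "\<bar>i\<bar> > e" for x y i
  proof (cases "i > 0")
    case True
    then show ?thesis using d[OF that(1,2)] that(3) by (simp add: e_def)
  next
    case False
    then have "i < 0" using that(3) by (simp add: e_def)
    then have "shift C i y \<in> perp C M {..0}"
      unfolding perp_shift_iff[OF heart_Obj[OF that(2)]] using that(2) heart_iff by (auto simp: perp_def)
    moreover have "x \<in> perp C M {0<..}"
      using that(1) heart_iff by (auto simp: perp_def)
    ultimately show ?thesis using orthogonal by blast
  qed
  obtain K where K: "0 \<le> K" "t \<in> perp C M (- {- K..K})"
    using bounded_amplitude[OF t] .
  obtain L where L: "0 \<le> L" "s \<in> perp C M (- {- L..L})"
    using bounded_amplitude[OF s] .
  have to: "t \<in> Obj C" and so: "s \<in> Obj C" using t s bounded_objects_iff by auto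
  have 1: "hom_vanishes C t (shift C i y)" if y: "y \<in> H" and i: "\<bar>i\<bar> > e + K" for y i
  proof (rule devissage[OF _ _ _ K(2), where P = "\<lambda>t. hom_vanishes C t (shift C i y)"])
    show "hom_vanishes C z (shift C i y)" if "zero_object C z" for z
      using hom_vanishes_zero_object(2)[OF that] shift_Obj heart_Obj y by blast
    show "hom_vanishes C y' (shift C i y)"
      if "dist_triangle C x y' z f g h" "hom_vanishes C x (shift C i y)" "hom_vanishes C z (shift C i y)"
      for x y' z f g h
      using vanishes_middle_contravariant[OF that] shift_Obj heart_Obj y by blast
    show "hom_vanishes C (shift C (- n) h) (shift C i y)" if "h \<in> H" "- K \<le> n" "n \<le> K" for h n
      using e[OF that(1) y, of "i + n"] i that hom_vanishes_shift_right[OF heart_Obj heart_Obj, OF that(1) y]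
      by auto
  qed
  have 2: "hom_vanishes C (shift C (- i) t) s" if i: "\<bar>i\<bar> > e + K + L" for i
  proof (rule devissage[OF _ _ _ L(2), where P = "\<lambda>s. hom_vanishes C (shift C (- i) t) s"])
    show "hom_vanishes C (shift C (- i) t) z" if "zero_object C z" for z
      using hom_vanishes_zero_object(1)[OF that shift_Obj[OF to]] .
    show "hom_vanishes C (shift C (- i) t) y'"
      if "dist_triangle C x y' z f g h" "hom_vanishes C (shift C (- i) t) x"
        "hom_vanishes C (shift C (- i) t) z" for x y' z f g h
      using vanishes_middle[OF that shift_Obj[OF to]] .
    show "hom_vanishes C (shift C (- i) t) (shift C (- n) h)" if "h \<in> H" "- L \<le> n" "n \<le> L" for h n
      using 1[OF that(1), of "i - n"] i that hom_vanishes_shift_right[OF to heart_Obj[OF that(1)], of "- i" "- n"]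
      by auto
  qed
  show ?thesis
    unfolding hom_bounded_def using 2 hom_vanishes_shift_left[OF to so] by blast
qed

text \<open>Membership in the heart is tested by morphisms from the compact objects
  \<open>N i\<close>, so it passes to the coproduct, of which each summand is a retract.\<close>

lemma heart_countable_sum:
  assumes "\<And>k :: nat. y k \<in> H"
  obtains s where "s \<in> H" "\<And>k. retract (y k) s"
proof -
  have y: "y k \<in> Obj C" for k using assms heart_Obj by blast
  obtain c \<iota> where cop: "is_coproduct C UNIV y c \<iota>"
    and v: "\<forall>x \<in> compact_objects C U. (\<forall>n. hom_vanishes C x (y n)) \<longrightarrow> hom_vanishes C x c"
    using countable_coproduct[of y, OF y] by metis
  have "hom_vanishes C (N i) c" if "i \<noteq> 0" for i
    using v N_compact assms that heart_iff perp_N_iff by auto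
  then have "c \<in> H"
    using heart_iff perp_N_iff coproduct_Obj[OF cop] by auto
  then show ?thesis
    using that coproduct_retract[OF cop] by blast
qed

text \<open>Bounds depending on the pair become a single one: countably many counterexamples are
  retracts of one pair \<open>s\<close>, \<open>t\<close>, whose own bound they contradict.\<close>

lemma uniform_bound:
  assumes "\<And>h h'. \<lbrakk>h \<in> H; h' \<in> H\<rbrakk> \<Longrightarrow> hom_bounded C h h'"
  shows "\<exists>d :: int. \<forall>x\<in>H. \<forall>y\<in>H. \<forall>i>d. hom_vanishes C x (shift C i y)"
proof (rule ccontr)
  assume "\<not> ?thesis"
  then have "\<forall>k :: nat. \<exists>x y i. x \<in> H \<and> y \<in> H \<and> i > int k \<and> \<not> hom_vanishes C x (shift C i y)"
    by blast
  then obtain x y i where xy: "\<And>k :: nat. x k \<in> H" "\<And>k. y k \<in> H" "\<And>k. i k > int k"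
    "\<And>k. \<not> hom_vanishes C (x k) (shift C (i k) (y k))"
    by metis
  obtain s where s: "s \<in> H" "\<And>k. retract (x k) s" using heart_countable_sum[of x] xy by blast
  obtain t where t: "t \<in> H" "\<And>k. retract (y k) t" using heart_countable_sum[of y] xy by blast
  obtain B where B: "\<And>n. \<bar>n\<bar> > B \<Longrightarrow> hom_vanishes C s (shift C n t)"
    using assms[OF s(1) t(1)] by (auto simp: hom_bounded_def)
  have "\<bar>i (nat B)\<bar> > B" using xy(3)[of "nat B"] by linarith
  then show False
    using hom_vanishes_retract[OF s(2) retract_shift[OF t(2)] B] xy(4) by blast
qed

text \<open>The same packing in the second argument alone, for a fixed \<open>t\<close> and degrees
  of both signs.\<close>

lemma uniform_bound_left:
  assumes "\<And>y. y \<in> H \<Longrightarrow> hom_bounded C t y" "t \<in> Obj C"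
  obtains B where "\<And>y n. \<lbrakk>y \<in> H; \<bar>n\<bar> > B\<rbrakk> \<Longrightarrow> hom_vanishes C t (shift C n y)" "0 \<le> B"
proof -
  have "\<exists>B. \<forall>y\<in>H. \<forall>n. \<bar>n\<bar> > B \<longrightarrow> hom_vanishes C t (shift C n y)"
  proof (rule ccontr)
    assume "\<not> ?thesis"
    then have "\<forall>k :: nat. \<exists>y i. y \<in> H \<and> \<bar>i\<bar> > int k \<and> \<not> hom_vanishes C t (shift C i y)"
      by blast
    then obtain y i where y: "\<And>k :: nat. y k \<in> H" "\<And>k. \<bar>i k\<bar> > int k"
      "\<And>k. \<not> hom_vanishes C t (shift C (i k) (y k))"
      by metis
    obtain s where s: "s \<in> H" "\<And>k. retract (y k) s" using heart_countable_sum[of y] y by blast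
    obtain B where B: "\<And>n. \<bar>n\<bar> > B \<Longrightarrow> hom_vanishes C t (shift C n s)"
      using assms(1)[OF s(1)] by (auto simp: hom_bounded_def)
    have "\<bar>i (nat B)\<bar> > B" using y(2)[of "nat B"] by linarith
    then show False
      using hom_vanishes_retract[OF retract_refl[OF assms(2)] retract_shift[OF s(2)] B] y(3) by blast
  qed
  then obtain B where "\<forall>y\<in>H. \<forall>n. \<bar>n\<bar> > B \<longrightarrow> hom_vanishes C t (shift C n y)" by blast
  then show ?thesis using that[of "max 0 B"] by simp
qed

text \<open>
  Without injective cogenerators the cohomology of \<open>t\<close> is detected as follows: the
  weight-like truncation \<open>t \<rightarrow> Q\<close> at \<open>k\<close> is bounded above and changes cohomology only in
  degrees \<open>\<ge> k - c - 1\<close>; its truncation \<open>W\<close> from below is then a bounded object receiving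
  no nonzero map from \<open>t\<close> once its amplitude lies outside \<open>{-B..B}\<close>.
\<close>

lemma bounded_projective_subset_bounded:
  assumes M: "hom_bounded C M M"
  shows "bounded_projective_objects C U \<subseteq> bounded_objects C U"
proof
  fix t assume t: "t \<in> bounded_projective_objects C U"
  have to: "t \<in> Obj C" using t by (simp add: bounded_projective_objects_def)
  have "hom_bounded C t y" if "y \<in> H" for y
    using t heart_bounded[OF that] by (simp add: bounded_projective_objects_def)
  then obtain B where B: "\<And>y n. \<lbrakk>y \<in> H; \<bar>n\<bar> > B\<rbrakk> \<Longrightarrow> hom_vanishes C t (shift C n y)" "0 \<le> B"
    using uniform_bound_left[OF _ to] by blast
  obtain c where c: "\<And>n. \<bar>n\<bar> > c \<Longrightarrow> hom_vanishes C M (shift C n M)" "0 \<le> c"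
  proof -
    obtain c where "\<And>n. \<bar>n\<bar> > c \<Longrightarrow> hom_vanishes C M (shift C n M)"
      using M by (auto simp: hom_bounded_def)
    then show thesis using that[of "max 0 c"] by simp
  qed
  \<comment> \<open>A range \<open>{a..b}\<close> that misses \<open>{- B..B}\<close> involves only
    shifted heart objects with no nonzero morphism from \<open>t\<close>.\<close>
  have none: "hom_vanishes C t W" if W: "W \<in> perp C M (- {a..b})" and ab: "B < a \<or> b < - B" for W a b
  proof (rule devissage[OF _ _ _ W, where P = "hom_vanishes C t"])
    show "hom_vanishes C t z" if "zero_object C z" for z
      using hom_vanishes_zero_object(1)[OF that to] .
    show "hom_vanishes C t y" if "dist_triangle C x y z f g h" "hom_vanishes C t x" "hom_vanishes C t z"
      for x y z f g h
      using vanishes_middle[OF that to] .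
    show "hom_vanishes C t (shift C (- n) h)" if "h \<in> H" "a \<le> n" "n \<le> b" for h n
      using B(1)[OF that(1), of "- n"] that ab by linarith
  qed
  \<comment> \<open>The condition on \<open>n\<close> and \<open>k - c - 1\<close> keeps t -> Q -> W
    injective on morphisms from \<open>N n\<close>. The amplitude of \<open>W\<close> lies in
    \<open>{n..k}\<close>, which the second condition moves away from
    \<open>{- B..B}\<close>.\<close>
  have key: "hom_vanishes C (N n) t" if n: "n < k - c - 1" and nk: "B < n \<or> k < - B" for n k
  proof -
    \<comment> \<open>Here \<open>j - i < - c\<close>, so it is boundedness of \<open>M\<close> in
      negative degrees that enters, not the silting condition.\<close>
    have MM: "hom_vanishes C M (shift C (j - i) M)" if "i \<in> {k<..}" "j \<in> {..<k - c}" for i j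
      using c(1)[of "j - i"] that by auto
    obtain Q Z f g h where tri: "dist_triangle C t Q Z f g h" and Q: "Q \<in> perp C M {k<..}"
      and Z: "\<forall>j \<in> {..<k - c}. hom_vanishes C (N (j - 1)) Z"
      using approximation[OF to MM] by metis
    have Z': "hom_vanishes C (N j) Z" if "j < k - c - 1" for j
      using bspec[OF Z, of "j + 1"] that by simp
    note D = dist_triangleD[OF tri]
    obtain W Y f' g' h' where tri': "dist_triangle C Q W Y f' g' h'" and W: "W \<in> perp C M {..n - 1}"
      and Y: "\<forall>j\<ge>n - 1. hom_vanishes C (N j) Y"
      using truncation[OF D(5), of "n - 1"] by metis
    note D' = dist_triangleD[OF tri']
    have "hom_vanishes C (N i) W" if "i > k" for i
    proof -
      have "hom_vanishes C (N i) Q" using Q that perp_N_iff by auto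
      then show ?thesis using vanishes_middle[OF tri' _ _ N_Obj] Y that n c(2) by simp
    qed
    then have "W \<in> perp C M (- {n..k})"
      using W perp_N_iff by auto
    then have tW: "hom_vanishes C t W"
      using none nk by blast
    \<comment> \<open>Both maps of the composite t -> Q -> W are injective on morphisms from
      \<open>N n\<close>, but the composite is zero by \<open>tW\<close>.\<close>
    have inj_t: "a = Zero C (N n) t" if "a \<in> Hom C (N n) t" "f \<cdot> a = Zero C (N n) Q" for a
      using inj_on_hom[OF tri _ that] Z'[of "n - 1"] n ShiftO_N by simp
    have inj_Q: "a = Zero C (N n) Q" if "a \<in> Hom C (N n) Q" "f' \<cdot> a = Zero C (N n) W" for a
      using inj_on_hom[OF tri' _ that] spec[OF Y, of "n - 1"] ShiftO_N[of n] by simp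
    have "a = Zero C (N n) t" if a: "a \<in> Hom C (N n) t" for a
    proof -
      have "f' \<cdot> (f \<cdot> a) = Zero C (N n) W"
        using Comp_assoc[OF a D(1) D'(1)] hom_vanishesD[OF tW Comp_Hom[OF D(1) D'(1)]]
          Comp_Zero_left[OF a D'(5)] by simp
      then show ?thesis
        using inj_Q[OF Comp_Hom[OF a D(1)]] inj_t[OF a] by simp
    qed
    then show ?thesis
      using hom_vanishes_iff[OF N_Obj to] by blast
  qed
  \<comment> \<open>For positive \<open>n\<close> the choice \<open>k = n + c + 2\<close> gives a
    range starting above \<open>B\<close>; for negative \<open>n\<close> the choice
    \<open>k = - B - 1\<close> gives one ending below \<open>- B\<close>. The slack
    \<open>c + 2\<close> is what \<open>key\<close> demands.\<close>
  have "hom_vanishes C M (shift C n t)" if n: "\<bar>n\<bar> > B + c + 2" for n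
  proof -
    have "hom_vanishes C (N n) t"
    proof (cases "n > 0")
      case True
      then show ?thesis using key[of n "n + c + 2"] n c(2) by simp
    next
      case False
      then show ?thesis using key[of n "- B - 1"] n by simp
    qed
    then show ?thesis
      using hom_vanishes_shift_left[OF M_Obj to] by simp
  qed
  then show "t \<in> bounded_objects C U"
    using to bounded_objects_iff unfolding hom_bounded_def by blast
qed

lemma gldim_finite_equivalences:
  "gldim C H < \<infinity> \<longleftrightarrow> bounded_objects C U \<subseteq> bounded_projective_objects C U"
  "bounded_objects C U \<subseteq> bounded_projective_objects C U \<longleftrightarrow>
    bounded_objects C U \<subseteq> bounded_injective_objects C U"
  "hom_bounded C M M \<Longrightarrow> gldim C H < \<infinity> \<longleftrightarrow> finite_global_dimension C U"
proof -
  \<comment> \<open>This form treats the two arguments alike, so (ii) and (iii) unfold to the same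
    condition.\<close>
  have 1: "bounded_objects C U \<subseteq> bounded_projective_objects C U \<longleftrightarrow>
    (\<forall>t \<in> bounded_objects C U. \<forall>s \<in> bounded_objects C U. hom_bounded C t s)"
    by (auto simp: bounded_projective_objects_def bounded_objects_iff)
  show "bounded_objects C U \<subseteq> bounded_projective_objects C U \<longleftrightarrow>
    bounded_objects C U \<subseteq> bounded_injective_objects C U"
    unfolding 1 by (auto simp: bounded_injective_objects_def bounded_objects_iff)
  show 2: "gldim C H < \<infinity> \<longleftrightarrow> bounded_objects C U \<subseteq> bounded_projective_objects C U"
    unfolding gldim_finite_iff 1 using hom_bounded_of_heart uniform_bound heart_bounded by meson
  \<comment> \<open>Once bounded projective objects are known to be bounded, equality of the two
    classes amounts to the inclusion (ii).\<close>
  show "gldim C H < \<infinity> \<longleftrightarrow> finite_global_dimension C U" if "hom_bounded C M M"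
    unfolding 2 finite_global_dimension_def using bounded_projective_subset_bounded[OF that] by blast
qed

end

theorem theorem2p9:
  fixes C :: "('o, 'm) tricat" and U :: "'u set" and M :: 'o
  defines "H \<equiv> heart C (silting_t_structure C M)"
  assumes "compactly_generated_category C U"
    and "compact_silting C U M"
  shows "((gldim C H < \<infinity>) \<longleftrightarrow> bounded_objects C U \<subseteq> bounded_projective_objects C U) \<and>
    (bounded_objects C U \<subseteq> bounded_projective_objects C U \<longleftrightarrow>
       bounded_objects C U \<subseteq> bounded_injective_objects C U) \<and>
    (hom_bounded C M M \<longrightarrow> ((gldim C H < \<infinity>) \<longleftrightarrow> finite_global_dimension C U))"
proof -
  interpret silting_category C U M
    using assms(2,3) by (simp add: silting_category_def silting_category_axioms_def)
  show ?thesis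
    unfolding H_def using gldim_finite_equivalences by blast
qed

end
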